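(* Let $\wp\in P^{2n}$. Every symplectic loaf in $M(n,\mathbb C)$ defined by the Poisson structure $\{\cdot,\cdot\}_\wp$ is equal to the image, under the projection $M(n,\mathbb C)\times(\mathbb C^* )^{2n-1}\to M(n,\mathbb C)$ onto the first factor, of a symplectic leaf of $M(n,\mathbb C)\times(\mathbb C^* )^{2n-1}$ (with its Poisson structure determined by $\wp$).
   Context: $P$ is the free abelian group with basis $\lambda_\beta,\lambda_{\mu_1},\dots,\lambda_{\mu_{n-1}},\lambda_{\nu_1},\dots,\lambda_{\nu_{n-1}}$; also write these $2n-1$ elements as $\lambda_1,\dots,\lambda_{2n-1}$. For $1\le i,j\le n$ the symbols $\alpha_{i,j}$ pair additively with $P$ by $(\lambda_\beta|\alpha_{i,j})=1$, $(\lambda_{\mu_k}|\alpha_{i,j})=1$ if $k<i$ and $0$ otherwise, $(\lambda_{\nu_k}|\alpha_{i,j})=1$ if $k<j$ and $0$ otherwise; $(\alpha|\lambda)=(\lambda|\alpha)$. Let $a_{ij}$ be the coordinate functions on $M(n,\mathbb C)$. The standard (holomorphic) Poisson bracket is determined by antisymmetry and $\{a_{ij},a_{ik}\}_0=a_{ij}a_{ik}$ if $j<k$; $\{a_{ij},a_{kj}\}_0=a_{ij}a_{kj}$ if $i<k$; $\{a_{ij},a_{st}\}_0=0$ if $i<s$, $t<j$; $\{a_{ij},a_{st}\}_0=2a_{it}a_{sj}$ if $i<s$, $j<t$. For $\wp=(\zeta_1,\dots,\zeta_n,\xi_1,\dots,\xi_n)\in P^{2n}$, $$\{a_{ij},a_{st}\}_\wp=\{a_{ij},a_{st}\}_0+\big((\alpha_{s,t}|\zeta_i+\xi_j)-(\alpha_{i,j}|\zeta_s+\xi_t)\big)a_{ij}a_{st}.$$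 On $M(n,\mathbb C)\times(\mathbb C^* )^{2n-1}$, with $\ell_1,\dots,\ell_{2n-1}$ the coordinates on the second factor, the Poisson structure determined by $\wp$ is: $\{a_{ij},a_{st}\}_\wp=\{a_{ij},a_{st}\}_0+\big((\alpha_{s,t}|\zeta_i+\xi_j)-(\alpha_{i,j}|\zeta_s+\xi_t)\big)a_{ij}a_{st}$, $\{\ell_k,a_{ij}\}_\wp=(\lambda_k|\alpha_{i,j})a_{ij}\ell_k$, $\{\ell_r,\ell_s\}_\wp=0$. A symplectic leaf is a maximal (connected) integral manifold of the involutive distribution assigning to a point the complex span of the values there of the Hamiltonian vector fields. The group $\mathcal S_{\rm mult}\cong(\mathbb C^* )^{2n-1}$ is generated by the maps $\check\lambda_k(c)$, $c\in\mathbb C^*$, $1\le k\le 2n-1$, acting on $M(n,\mathbb C)$ by $a_{st}\mapsto c^{(\alpha_{s,t}|\lambda_k)}a_{st}$. A symplectic loaf in $M(n,\mathbb C)$ is a set $\mathcal S_{\rm mult}(\mathcal L)$ with $\mathcal L$ a symplectic leaf in $M(n,\mathbb C)$. *)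

theory Defs
  imports "HOL-Analysis.Analysis" "HOL-Algebra.Bij" "HOL-Algebra.Generated_Groups"
begin

text \<open>A holomorphic Poisson structure on an open set \<open>M\<close> of \<open>complex ^ 'c\<close> is given by the brackets
  \<open>\<pi> b c = {x_b, x_c}\<close> of the coordinate functions; the bracket of arbitrary holomorphic functions
  is its extension as a biderivation.\<close>

type_synonym 'c coord_brackets = "'c \<Rightarrow> 'c \<Rightarrow> complex ^ 'c \<Rightarrow> complex"

definition holo_fun_on :: "(complex ^ 'c::finite) set \<Rightarrow> (complex ^ 'c \<Rightarrow> complex) \<Rightarrow> bool" where
  "holo_fun_on M f \<longleftrightarrow>
     (\<forall>x\<in>M. \<exists>f'. (f has_derivative f') (at x) \<and> (\<forall>c v. f' (c *s v) = c * f' v))"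

definition partial :: "'c \<Rightarrow> (complex ^ 'c::finite \<Rightarrow> complex) \<Rightarrow> complex ^ 'c \<Rightarrow> complex" where
  "partial b f x = deriv (\<lambda>z. f (x + z *s axis b 1)) 0"

definition poisson_bracket ::
  "'c::finite coord_brackets \<Rightarrow> (complex ^ 'c \<Rightarrow> complex) \<Rightarrow> (complex ^ 'c \<Rightarrow> complex)
     \<Rightarrow> complex ^ 'c \<Rightarrow> complex" where
  "poisson_bracket \<pi> f g x = (\<Sum>b\<in>UNIV. \<Sum>c\<in>UNIV. partial b f x * partial c g x * \<pi> b c x)"

text \<open>The vector field \<open>{f, \<sqdot>}\<close>; the sign convention does not affect the span below.\<close>

definition ham_field ::
  "'c::finite coord_brackets \<Rightarrow> (complex ^ 'c \<Rightarrow> complex) \<Rightarrow> complex ^ 'c \<Rightarrow> complex ^ 'c" where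
  "ham_field \<pi> f x = (\<chi> c. poisson_bracket \<pi> f (\<lambda>y. y $ c) x)"

definition ham_distribution ::
  "'c::finite coord_brackets \<Rightarrow> (complex ^ 'c) set \<Rightarrow> complex ^ 'c \<Rightarrow> (complex ^ 'c) set" where
  "ham_distribution \<pi> M x = vec.span {ham_field \<pi> f x | f. holo_fun_on M f}"

text \<open>A chart of an injectively immersed complex submanifold, whose underlying set is the carrier
  of \<open>T\<close> and whose manifold topology is \<open>T\<close> (possibly finer than the subspace topology), tangent
  to the distribution \<open>D\<close>. The model space is a complex linear subspace \<open>S\<close> of the ambient space
  in place of an abstract \<open>\<complex>\<^sup>d\<close>, since the dimension \<open>d\<close> depends on the submanifold. As \<open>\<phi>\<close> is also
  the inclusion map read in the chart, the derivative condition says that the inclusion is a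
  holomorphic immersion with tangent spaces \<open>D\<close>. Transition maps between two such charts are then
  automatically holomorphic, so that no atlas has to be recorded.\<close>

definition integral_chart ::
  "(complex ^ 'c::finite \<Rightarrow> (complex ^ 'c) set) \<Rightarrow> (complex ^ 'c) topology
     \<Rightarrow> (complex ^ 'c) set \<Rightarrow> (complex ^ 'c) set \<Rightarrow> (complex ^ 'c \<Rightarrow> complex ^ 'c) \<Rightarrow> bool" where
  "integral_chart D T S W \<phi> \<longleftrightarrow>
     vec.subspace S \<and> openin (top_of_set S) W \<and> openin T (\<phi> ` W) \<and>
     homeomorphic_map (top_of_set W) (subtopology T (\<phi> ` W)) \<phi> \<and>
     (\<forall>w\<in>W. \<exists>\<phi>'. (\<phi> has_derivative \<phi>') (at w within W) \<and>
        Vector_Spaces.linear (*s) (*s) \<phi>' \<and> inj_on \<phi>' S \<and> \<phi>' ` S = D (\<phi> w))"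

text \<open>No separation or countability axiom is needed: \<open>T\<close> refines the subspace topology, hence is
  Hausdorff, and a connected manifold immersed in \<open>complex ^ 'c\<close> is second countable.\<close>

definition connected_integral_manifold ::
  "(complex ^ 'c::finite \<Rightarrow> (complex ^ 'c) set) \<Rightarrow> (complex ^ 'c) set \<Rightarrow> (complex ^ 'c) topology
     \<Rightarrow> bool" where
  "connected_integral_manifold D M T \<longleftrightarrow>
     topspace T \<noteq> {} \<and> topspace T \<subseteq> M \<and> connected_space T \<and>
     (\<forall>x\<in>topspace T. \<exists>S W \<phi>. integral_chart D T S W \<phi> \<and> x \<in> \<phi> ` W)"

definition symplectic_leaf ::
  "'c::finite coord_brackets \<Rightarrow> (complex ^ 'c) set \<Rightarrow> (complex ^ 'c) set \<Rightarrow> bool" where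
  "symplectic_leaf \<pi> M L \<longleftrightarrow>
     (\<exists>T. connected_integral_manifold (ham_distribution \<pi> M) M T \<and> topspace T = L) \<and>
     (\<forall>T'. connected_integral_manifold (ham_distribution \<pi> M) M T' \<and> L \<subseteq> topspace T'
        \<longrightarrow> topspace T' = L)"

text \<open>Matrix indices range over a finite linear order \<open>'n\<close>, standing for \<open>{1..n}\<close> with
  \<open>n = CARD('n)\<close>. The indices \<open>k \<in> {1..n-1}\<close> of \<open>\<lambda>_{\<mu>_k}\<close> and \<open>\<lambda>_{\<nu>_k}\<close> are those that are not the
  greatest element.\<close>

datatype 'n raw_weight = Beta | Mu 'n | Nu 'n

typedef (overloaded) 'n weight =
  "{Beta} \<union> {Mu k | k. \<exists>i. k < i} \<union> {Nu k | k. \<exists>i. k < i} :: 'n::{finite,linorder} raw_weight set"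
  by blast

instance weight :: ("{finite,linorder}") finite
proof
  have "x \<in> {Beta} \<union> range Mu \<union> range Nu" for x :: "'a raw_weight"
    by (cases x) simp_all
  then have "(UNIV :: 'a raw_weight set) \<subseteq> {Beta} \<union> range Mu \<union> range Nu" by blast
  moreover have "finite ({Beta} \<union> range Mu \<union> range Nu :: 'a raw_weight set)" by simp
  ultimately have "finite (UNIV :: 'a raw_weight set)" by (rule finite_subset)
  then have "finite (range (Rep_weight :: 'a weight \<Rightarrow> 'a raw_weight))"
    by (rule finite_subset[rotated]) simp
  then show "finite (UNIV :: 'a weight set)"
    by (rule finite_imageD) (simp add: inj_on_def Rep_weight_inject)
qed

lemma card_weight: "CARD('n::{finite,linorder} weight) = 2 * CARD('n) - 1"
proof -
  define N where "N = {k::'n. \<exists>i. k < i}"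
  have "k \<in> N \<longleftrightarrow> k \<noteq> Max UNIV" for k :: 'n
  proof
    assume "k \<in> N"
    then obtain i where "k < i" by (auto simp: N_def)
    moreover have "i \<le> Max UNIV" by simp
    ultimately show "k \<noteq> Max UNIV" by auto
  next
    assume "k \<noteq> Max UNIV"
    moreover have "k \<le> Max UNIV" by simp
    ultimately have "k < Max UNIV" by (rule le_neq_trans[rotated])
    then show "k \<in> N" unfolding N_def by blast
  qed
  then have "N = UNIV - {Max UNIV}" by blast
  then have N: "card N = CARD('n) - 1" by simp
  have inj: "inj_on Mu N" "inj_on Nu N" by (auto simp: inj_on_def)
  have disj: "Mu ` N \<inter> Nu ` N = {}" "Beta \<notin> Mu ` N \<union> Nu ` N" by auto
  have "CARD('n weight)
      = card ({Beta} \<union> {Mu k | k. \<exists>i. k < i} \<union> {Nu k | k. \<exists>i. k < i} :: 'n raw_weight set)"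
    by (rule type_definition.card[OF type_definition_weight])
  also have "{Beta} \<union> {Mu k | k. \<exists>i. k < i} \<union> {Nu k | k. \<exists>i. k < i} = insert Beta (Mu ` N \<union> Nu ` N)"
    unfolding N_def by blast
  also have "card \<dots> = Suc (card (Mu ` N \<union> Nu ` N))"
    using disj(2) by simp
  also have "card (Mu ` N \<union> Nu ` N) = 2 * card N"
    using disj(1) inj by (simp add: card_Un_disjoint card_image)
  finally show ?thesis
    using N zero_less_card_finite[where 'a='n] by linarith
qed

text \<open>An element of \<open>P\<close> is given by its coefficients in the basis of the \<open>\<lambda>_k\<close>; the pair \<open>(i, j)\<close>
  stands for \<open>\<alpha>_{i,j}\<close>.\<close>

type_synonym 'n lattice_P = "int ^ 'n weight"

fun raw_pair :: "'n::linorder raw_weight \<Rightarrow> 'n \<times> 'n \<Rightarrow> int" where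
  "raw_pair Beta (i, j) = 1"
| "raw_pair (Mu k) (i, j) = (if k < i then 1 else 0)"
| "raw_pair (Nu k) (i, j) = (if k < j then 1 else 0)"

definition basis_pair :: "'n::{finite,linorder} weight \<Rightarrow> 'n \<times> 'n \<Rightarrow> int" where
  "basis_pair k \<alpha> = raw_pair (Rep_weight k) \<alpha>"

definition pairing :: "'n::{finite,linorder} lattice_P \<Rightarrow> 'n \<times> 'n \<Rightarrow> int" where
  "pairing p \<alpha> = (\<Sum>k\<in>UNIV. p $ k * basis_pair k \<alpha>)"

text \<open>\<open>M(n, \<complex>)\<close> is \<open>complex ^ ('n \<times> 'n)\<close>, with \<open>a_{ij}\<close> the coordinate \<open>a $ (i, j)\<close>. The listed
  values of the standard bracket are those of \<open>std_pos\<close>, which is \<open>0\<close> on all other pairs;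
  antisymmetrising fills in the remaining ones.\<close>

fun std_pos :: "'n::{finite,linorder} \<times> 'n \<Rightarrow> 'n \<times> 'n \<Rightarrow> complex ^ ('n \<times> 'n) \<Rightarrow> complex" where
  "std_pos (i, j) (s, t) a =
     (if i = s \<and> j < t then a $ (i, j) * a $ (i, t)
      else if i < s \<and> j = t then a $ (i, j) * a $ (s, j)
      else if i < s \<and> j < t then 2 * a $ (i, t) * a $ (s, j)
      else 0)"

definition std_bracket :: "('n::{finite,linorder} \<times> 'n) coord_brackets" where
  "std_bracket p q a = std_pos p q a - std_pos q p a"

text \<open>The element \<open>\<wp> = (\<zeta>_1, \<dots>, \<zeta>_n, \<xi>_1, \<dots>, \<xi>_n)\<close> of \<open>P^{2n}\<close> is given by the two families \<open>\<zeta>\<close> and \<open>\<xi>\<close>.\<close>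

fun mat_bracket ::
  "('n::{finite,linorder} \<Rightarrow> 'n lattice_P) \<Rightarrow> ('n \<Rightarrow> 'n lattice_P) \<Rightarrow> ('n \<times> 'n) coord_brackets" where
  "mat_bracket \<zeta> \<xi> (i, j) (s, t) a =
     std_bracket (i, j) (s, t) a
     + of_int (pairing (\<zeta> i + \<xi> j) (s, t) - pairing (\<zeta> s + \<xi> t) (i, j)) * a $ (i, j) * a $ (s, t)"

text \<open>The product \<open>M(n, \<complex>) \<times> (\<complex>\<^sup>*)\<^bsup>2n-1\<^esup>\<close> is an open subset of an affine space with the \<open>a_{ij}\<close> as
  its \<open>Inl\<close>-coordinates and the \<open>\<ell>_k\<close> as its \<open>Inr\<close>-coordinates.\<close>

definition prod_space :: "(complex ^ ('n \<times> 'n + 'n::{finite,linorder} weight)) set" where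
  "prod_space = {x. \<forall>k. x $ Inr k \<noteq> 0}"

definition mat_proj ::
  "complex ^ ('n \<times> 'n + 'n::{finite,linorder} weight) \<Rightarrow> complex ^ ('n \<times> 'n)" where
  "mat_proj x = (\<chi> p. x $ Inl p)"

fun prod_bracket ::
  "('n::{finite,linorder} \<Rightarrow> 'n lattice_P) \<Rightarrow> ('n \<Rightarrow> 'n lattice_P)
     \<Rightarrow> ('n \<times> 'n + 'n weight) coord_brackets" where
  "prod_bracket \<zeta> \<xi> (Inl p) (Inl q) x = mat_bracket \<zeta> \<xi> p q (mat_proj x)"
| "prod_bracket \<zeta> \<xi> (Inr k) (Inl p) x = of_int (basis_pair k p) * x $ Inl p * x $ Inr k"
| "prod_bracket \<zeta> \<xi> (Inl p) (Inr k) x = - of_int (basis_pair k p) * x $ Inl p * x $ Inr k"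
| "prod_bracket \<zeta> \<xi> (Inr r) (Inr s) x = 0"

definition lambda_check ::
  "'n::{finite,linorder} weight \<Rightarrow> complex \<Rightarrow> complex ^ ('n \<times> 'n) \<Rightarrow> complex ^ ('n \<times> 'n)" where
  "lambda_check k c a = (\<chi> p. c powi basis_pair k p * a $ p)"

definition S_mult :: "(complex ^ ('n \<times> 'n) \<Rightarrow> complex ^ ('n \<times> 'n::{finite,linorder})) set" where
  "S_mult = generate (BijGroup UNIV) {lambda_check k c | k c. c \<noteq> 0}"

definition symplectic_loaf ::
  "('n::{finite,linorder} \<Rightarrow> 'n lattice_P) \<Rightarrow> ('n \<Rightarrow> 'n lattice_P)
     \<Rightarrow> (complex ^ ('n \<times> 'n)) set \<Rightarrow> bool" where
  "symplectic_loaf \<zeta> \<xi> K \<longleftrightarrow>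
     (\<exists>L. symplectic_leaf (mat_bracket \<zeta> \<xi>) UNIV L \<and> K = (\<Union>g\<in>S_mult. g ` L))"

end

theory Submission
  imports Defs "HOL-Complex_Analysis.Cauchy_Integral_Formula"
begin

text \<open>Every leaf, of either Poisson structure, is an orbit of the group generated by the Hamiltonian flows
of the coordinate functions, and on orbits the statement is visible. On the product, the flow of
\<open>a_{ij}\<close> lies over the flow of \<open>a_{ij}\<close> on \<open>M(n, \<complex>)\<close>, while the flow of \<open>\<ell>_k\<close> fixes
\<open>\<ell>_k\<close> and multiplies \<open>a_{st}\<close> by \<open>exp ((\<lambda>_k|\<alpha>_{st}) \<ell>_k t)\<close>, so it lies over the element
\<open>exp (\<ell>_k t)\<close> of the \<open>k\<close>-th one-parameter subgroup of the torus; as \<open>\<ell>_k\<close> does not vanish,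
every element of that subgroup occurs. The torus carries flow lines on \<open>M(n, \<complex>)\<close> to flow lines
up to a rescaling of time (\<open>mat_flow_rescale\<close>). Hence the orbit of \<open>(a, 1, \<dots>, 1)\<close> projects onto the
torus saturation of the orbit of \<open>a\<close>, which is the loaf of \<open>a\<close>.

Two things make leaves and orbits the same. First, the flows are complete and explicit. Both
brackets have the form \<open>{x_b, x_c} = \<tau>_{bc} x_b x_c + \<theta>_{bc} x_{m b c} x_{m c b}\<close>, where for matrix
entries \<open>m (i, j) (s, t) = (i, t)\<close>: the second term exchanges the column indices. Along the flow of
\<open>x_b\<close> the coordinate \<open>x_b\<close> is constant, the two exchanged entries are multiplied by exponentials, and
\<open>x_c\<close> solves a linear equation whose inhomogeneity is their product. Secondly, these flows preserve
the bracket (\<open>flow_poisson\<close>). By the group law, the bracket pulled back along a flow has derivative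
zero as soon as it does at time zero, where this is the Jacobi identity. For the standard bracket the
Jacobi identity reduces to a cocycle property of the sign function of a linear order.

A flow that preserves the bracket preserves the Hamiltonian distribution, so the rank is constant on
an orbit, and composing the flows of coordinates \<open>b\<^sub>1, \<dots>, b\<^sub>r\<close> whose Hamiltonian vectors form a
basis at \<open>x\<close> gives an integral chart through \<open>x\<close>. Adding transversal coordinates turns it into a local
diffeomorphism; a map of the same rank that is tangent to the distribution has constant
transversal coordinates (\<open>slice_chart_exists\<close>). This shows that the charts are compatible, and that
a connected integral manifold cannot leave an orbit (\<open>symplectic_leaf_iff_orbit\<close>).\<close>

section \<open>The Hamiltonian distribution as the image of the bracket matrix\<close>

definition bracket_matrix :: "'c::finite coord_brackets \<Rightarrow> complex ^ 'c \<Rightarrow> complex ^ 'c ^ 'c" where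
  "bracket_matrix \<pi> x = (\<chi> b c. \<pi> b c x)"

lemma holo_fun_on_coord: "holo_fun_on M (\<lambda>y. y $ b)"
  unfolding holo_fun_on_def
proof (intro ballI exI conjI allI)
  show "((\<lambda>y. y $ b) has_derivative (\<lambda>v. v $ b)) (at x)" for x :: "complex ^ 'a"
    by (rule bounded_linear_imp_has_derivative[OF bounded_linear_vec_nth])
qed simp

lemma partial_coord: "partial b (\<lambda>y. y $ d) x = (if b = d then 1 else 0)"
proof -
  have "((\<lambda>z. x $ d + z * (if b = d then 1 else 0)) has_field_derivative (if b = d then 1 else 0)) (at 0)"
    by (auto intro!: derivative_eq_intros)
  then show ?thesis
    unfolding partial_def by (auto simp: axis_def intro!: DERIV_imp_deriv)
qed

lemma ham_field_eq: "ham_field \<pi> f x = (\<Sum>b\<in>UNIV. partial b f x *s row b (bracket_matrix \<pi> x))"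
  by (simp add: ham_field_def poisson_bracket_def partial_coord vec_eq_iff row_def
      bracket_matrix_def if_distrib if_distribR cong: if_cong)

text \<open>A skew matrix has the same row space and column space, which is why the span of the Hamiltonian
vectors (rows) can be handled as the range of a linear map.\<close>

lemma mult_eq_row_sum:
  assumes skew: "\<And>b c. \<pi> b c x = - \<pi> c b x"
  shows "bracket_matrix \<pi> x *v u = (\<Sum>b\<in>UNIV. (- u $ b) *s row b (bracket_matrix \<pi> x))"
proof -
  have "\<pi> c b x * u $ b = - u $ b * \<pi> b c x" for b c
    by (subst skew) simp
  then show ?thesis
    by (simp add: vec_eq_iff row_def bracket_matrix_def matrix_vector_mult_def)
qed

lemma row_eq_mult:
  assumes skew: "\<And>b c. \<pi> b c x = - \<pi> c b x"
  shows "row b (bracket_matrix \<pi> x) = bracket_matrix \<pi> x *v axis b (-1)"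
proof -
  have "(- axis b (- 1) $ c) * \<pi> c d x = (if c = b then \<pi> b d x else 0)" for c d
    by (simp add: axis_def)
  then show ?thesis
    unfolding mult_eq_row_sum[of \<pi> x, OF skew] 
    by (simp add: vec_eq_iff row_def bracket_matrix_def)
qed

text \<open>Hamiltonian vectors depend on the function only through its first derivatives, so the coordinate
functions already span the distribution.\<close>

lemma ham_distribution_eq_range:
  assumes skew: "\<And>b c. \<pi> b c x = - \<pi> c b x"
  shows "ham_distribution \<pi> M x = range ((*v) (bracket_matrix \<pi> x))"
proof -
  let ?A = "bracket_matrix \<pi> x"
  note row = row_eq_mult[of \<pi> x, OF skew]
  have sub: "vec.subspace (range ((*v) ?A))"
    by (rule vec.subspace_image) auto
  show ?thesis
  proof (rule subset_antisym)
    have "ham_field \<pi> f x \<in> range ((*v) ?A)" for f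
      unfolding ham_field_eq row
      by (intro vec.subspace_sum[OF sub] vec.subspace_scale[OF sub]) auto
    then show "ham_distribution \<pi> M x \<subseteq> range ((*v) ?A)"
      unfolding ham_distribution_def by (intro vec.span_minimal sub) auto
    have rowin: "row b ?A \<in> ham_distribution \<pi> M x" for b
    proof -
      have "row b ?A = ham_field \<pi> (\<lambda>y. y $ b) x"
        by (simp add: ham_field_eq partial_coord vec_eq_iff if_distrib if_distribR cong: if_cong)
      then show ?thesis
        unfolding ham_distribution_def using holo_fun_on_coord by (intro vec.span_base) blast
    qed
    show "range ((*v) ?A) \<subseteq> ham_distribution \<pi> M x"
      using rowin unfolding mult_eq_row_sum[of \<pi> x, OF skew] ham_distribution_def
      by (intro image_subsetI vec.span_sum vec.span_scale)
  qed
qed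

text \<open>The columns are the Hamiltonian vectors of the coordinates in \<open>B\<close>, completed by the unit vectors
of the remaining coordinates.\<close>

definition basis_completion :: "'c::finite coord_brackets \<Rightarrow> 'c set \<Rightarrow> complex ^ 'c \<Rightarrow> complex ^ 'c ^ 'c" where
  "basis_completion \<pi> B x = (\<chi> c d. if d \<in> B then \<pi> d c x else if c = d then 1 else 0)"

definition coord_space :: "'c::finite set \<Rightarrow> (complex ^ 'c) set" where
  "coord_space B = {v. \<forall>c. c \<notin> B \<longrightarrow> v $ c = 0}"

definition erase :: "'c::finite set \<Rightarrow> complex ^ 'c \<Rightarrow> complex ^ 'c" where
  "erase B v = (\<chi> c. if c \<in> B then 0 else v $ c)"

lemma subspace_coord_space: "vec.subspace (coord_space B)"
  by (auto simp: vec.subspace_def coord_space_def)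

lemma erase_eq_0_iff: "erase B v = 0 \<longleftrightarrow> v \<in> coord_space B"
  by (auto simp: erase_def coord_space_def vec_eq_iff)

lemma dim_coord_space: "vec.dim (coord_space B) = card (B :: 'c::finite set)"
proof -
  let ?X = "(\<lambda>b. axis b 1 :: complex ^ 'c) ` B"
  have ind: "vec.independent ?X"
    by (rule vec.independent_mono[OF independent_cart_basis]) (auto simp: cart_basis_def)
  have "coord_space B \<subseteq> vec.span ?X"
  proof
    fix v :: "complex ^ 'c" assume v: "v \<in> coord_space B"
    have "v $ c = (\<Sum>b\<in>B. v $ b * axis b 1 $ c)" for c
    proof -
      have "(\<Sum>b\<in>B. v $ b * axis b 1 $ c) = (\<Sum>b\<in>B. if c = b then v $ c else 0)"
        by (intro sum.cong) (auto simp: axis_def)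
      also have "\<dots> = v $ c" using v by (auto simp: coord_space_def)
      finally show ?thesis by simp
    qed
    then have "v = (\<Sum>b\<in>B. v $ b *s axis b 1)"
      unfolding vec_eq_iff sum_component vector_smult_component by blast
    moreover have "axis b 1 \<in> vec.span ?X" if "b \<in> B" for b
      using that by (simp add: vec.span_base)
    then have "(\<Sum>b\<in>B. v $ b *s axis b 1) \<in> vec.span ?X"
      by (intro vec.span_sum vec.span_scale)
    ultimately show "v \<in> vec.span ?X" by simp
  qed
  moreover have "?X \<subseteq> coord_space B" by (auto simp: coord_space_def axis_def)
  ultimately have "vec.dim (coord_space B) = card ?X"
    using vec.basis_card_eq_dim[OF _ _ ind] by simp
  also have "\<dots> = card B" by (intro card_image) (auto simp: inj_on_def axis_eq_axis)
  finally show ?thesis .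
qed

lemma basis_completion_mult:
  "basis_completion \<pi> B x *v v = (\<Sum>b\<in>B. v $ b *s row b (bracket_matrix \<pi> x)) + erase B v"
proof -
  have "(basis_completion \<pi> B x *v v) $ c = ((\<Sum>b\<in>B. v $ b *s row b (bracket_matrix \<pi> x)) + erase B v) $ c" for c
  proof -
    have "(basis_completion \<pi> B x *v v) $ c
        = (\<Sum>d\<in>UNIV. (if d \<in> B then v $ d * \<pi> d c x else 0) + (if d = c then (if d \<in> B then 0 else v $ d) else 0))"
      by (auto simp: basis_completion_def matrix_vector_mult_def intro!: sum.cong)
    also have "\<dots> = (\<Sum>d\<in>B. v $ d * \<pi> d c x) + (if c \<in> B then 0 else v $ c)"
      by (simp add: sum.distrib sum.delta flip: sum.inter_restrict[of UNIV _ B, simplified])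
    finally show ?thesis by (simp add: row_def bracket_matrix_def erase_def)
  qed
  then show ?thesis by (simp add: vec_eq_iff)
qed

lemma row_in_range:
  assumes skew: "\<And>b c. \<pi> b c x = - \<pi> c b x"
  shows "row b (bracket_matrix \<pi> x) \<in> range ((*v) (bracket_matrix \<pi> x))"
  unfolding row_eq_mult[of \<pi> x, OF skew] by (rule rangeI)

lemma subspace_range_mult: "vec.subspace (range ((*v) (A :: complex ^ 'c ^ 'c::finite)))"
  by (rule vec.subspace_image) auto

text \<open>If the rows with index in \<open>B\<close> form a basis of the row space of a skew matrix, then its principal
minor on \<open>B\<close> is nonsingular: a combination of these rows that vanishes at the places in \<open>B\<close> is, by
skewness, orthogonal to the rows in \<open>B\<close>, hence to all rows, hence zero. So the vectors supported
off \<open>B\<close> are a complement of the distribution.\<close>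

lemma basis_completion_exists:
  assumes skew: "\<And>b c. \<pi> b c x = - \<pi> c b x"
  obtains B where "inj ((*v) (basis_completion \<pi> B x))"
    and "vec.dim (range ((*v) (bracket_matrix \<pi> x))) = card B"
proof -
  let ?A = "bracket_matrix \<pi> x" and ?H = "\<lambda>b. row b (bracket_matrix \<pi> x)"
  obtain R where R: "R \<subseteq> range ?H" "vec.independent R" "range ?H \<subseteq> vec.span R"
    "card R = vec.dim (range ?H)"
    by (rule vec.basis_exists)
  obtain B where B: "inj_on ?H B" "R = ?H ` B"
    using R(1) unfolding subset_image_inj by blast
  have "range ((*v) ?A) \<subseteq> vec.span (range ?H)"
    unfolding mult_eq_row_sum[of \<pi> x, OF skew]
    by (intro image_subsetI vec.span_sum vec.span_scale vec.span_base) auto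
  moreover have "range ?H \<subseteq> range ((*v) ?A)"
    using row_in_range[of \<pi> x, OF skew] by blast
  ultimately have span: "vec.span (range ?H) = range ((*v) ?A)"
    by (intro subset_antisym vec.span_minimal subspace_range_mult)
  have "vec.dim (range ((*v) ?A)) = card B"
    using R(4) B card_image[OF B(1)] span vec.dim_span by metis
  moreover have "inj ((*v) (basis_completion \<pi> B x))"
  proof (subst vec.linear_inj_iff_eq_0[OF matrix_vector_mul_linear_gen], intro allI impI)
    fix v assume v0: "basis_completion \<pi> B x *v v = 0"
    define w where "w = (\<Sum>b\<in>B. v $ b *s ?H b)"
    have eq: "w + erase B v = 0" using v0 by (simp add: basis_completion_mult w_def)
    have wB: "w $ c = 0" if "c \<in> B" for c
      using arg_cong[OF eq, of "\<lambda>u. u $ c"] that by (simp add: erase_def)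
    have Hw: "(\<Sum>b\<in>B. v $ b * ?H c $ b) = - w $ c" for c
    proof -
      have "v $ b * \<pi> c b x = - (v $ b * \<pi> b c x)" for b by (subst skew) simp
      then show ?thesis by (simp add: w_def row_def bracket_matrix_def sum_negf)
    qed
    have "?H c \<in> {h. (\<Sum>b\<in>B. v $ b * h $ b) = 0}" for c
    proof -
      have "vec.subspace {h. (\<Sum>b\<in>B. v $ b * h $ b) = 0}"
        by (auto simp: vec.subspace_def distrib_left sum.distrib mult.left_commute
            simp flip: sum_distrib_left)
      moreover have "R \<subseteq> {h. (\<Sum>b\<in>B. v $ b * h $ b) = 0}"
      proof (clarsimp simp: B(2))
        fix c assume "c \<in> B"
        have "(\<Sum>b\<in>B. v $ b * ?H c $ b) = - w $ c"
          by (rule Hw)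
        then show "(\<Sum>b\<in>B. v $ b * ?H c $ b) = 0" using wB[OF \<open>c \<in> B\<close>] by simp
      qed
      ultimately have "vec.span R \<subseteq> {h. (\<Sum>b\<in>B. v $ b * h $ b) = 0}"
        by (rule vec.span_minimal[rotated])
      then show ?thesis using R(3) by blast
    qed
    then have w: "w = 0" using Hw by (simp add: vec_eq_iff)
    have "v $ b = 0" if "b \<in> B" for b
    proof -
      have "(\<Sum>r\<in>R. v $ (the_inv_into B ?H r) *s r) = 0"
        using w unfolding w_def B(2) by (simp add: sum.reindex[OF B(1)] the_inv_into_f_f[OF B(1)])
      then have "v $ (the_inv_into B ?H r) = 0" if "r \<in> R" for r
        using vec.independentD[OF R(2) _ order.refl] that B(2) by simp
      then show ?thesis using that B by (metis image_eqI the_inv_into_f_f)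
    qed
    moreover have "v $ b = 0" if "b \<notin> B" for b
      using arg_cong[OF eq, of "\<lambda>u. u $ b"] w that by (simp add: erase_def)
    ultimately show "v = 0" by (auto simp: vec_eq_iff)
  qed
  ultimately show ?thesis using that by blast
qed

text \<open>Invertibility of the completed basis is an open condition, and at nearby points of the same rank it
forces the vectors supported off \<open>B\<close> to stay a complement of the distribution.\<close>

lemma complement_transversal:
  assumes skew: "\<And>b c. \<pi> b c x = - \<pi> c b x"
    and inj: "inj ((*v) (basis_completion \<pi> B x))"
    and dim: "vec.dim (range ((*v) (bracket_matrix \<pi> x))) = card B"
    and u: "erase B u \<in> range ((*v) (bracket_matrix \<pi> x))"
  shows "erase B u = 0"
proof -
  let ?N = "basis_completion \<pi> B x" and ?D = "range ((*v) (bracket_matrix \<pi> x))"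
  have "(*v) ?N ` coord_space B \<subseteq> ?D"
  proof clarify
    fix v :: "complex ^ 'a" assume "v \<in> coord_space B"
    then have "?N *v v = (\<Sum>b\<in>B. v $ b *s row b (bracket_matrix \<pi> x))"
      by (simp add: basis_completion_mult erase_eq_0_iff)
    also have "\<dots> \<in> ?D"
      by (intro vec.subspace_sum vec.subspace_scale subspace_range_mult row_in_range[of \<pi> x, OF skew])
    finally show "?N *v v \<in> ?D" .
  qed
  moreover have "vec.dim ((*v) ?N ` coord_space B) = card B"
    using vec.dim_image_eq[OF matrix_vector_mul_linear_gen inj_on_subset[OF inj subset_UNIV]]
      dim_coord_space by metis
  ultimately have "(*v) ?N ` coord_space B = ?D"
    using dim by (intro vec.subspace_dim_equal vec.subspace_image subspace_range_mult
        subspace_coord_space) auto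
  then obtain v where v: "v \<in> coord_space B" "erase B u = ?N *v v" using u by auto
  have "erase B u = ?N *v erase B u"
    unfolding basis_completion_mult by (simp add: erase_def vec_eq_iff)
  then have "erase B u = v" using inj v(2) by (metis injD)
  then have "erase B u \<in> coord_space B" using v(1) by simp
  then show ?thesis by (auto simp: erase_def coord_space_def vec_eq_iff)
qed

section \<open>Charts of orbits of complete Hamiltonian flows\<close>

lemma continuous_on_matrix_mult_complex:
  fixes A :: "'a::topological_space \<Rightarrow> complex ^ 'm::finite ^ 'k::finite" and B :: "'a \<Rightarrow> complex ^ 'l::finite ^ 'm"
  assumes "continuous_on S A" "continuous_on S B"
  shows "continuous_on S (\<lambda>x. A x ** B x)"
  unfolding matrix_matrix_mult_def
  by (intro continuous_intros assms)

lemma continuous_on_det_complex: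
  fixes A :: "'a::topological_space \<Rightarrow> complex ^ 'm::finite ^ 'm"
  assumes "continuous_on S A"
  shows "continuous_on S (\<lambda>x. det (A x))"
  unfolding det_def by (intro continuous_intros assms)

lemma linear_matrix_complex: "linear ((*v) (A :: complex ^ 'm::finite ^ 'k::finite))"
  by (rule linearI) (simp_all add: vec_eq_iff matrix_vector_mult_def algebra_simps sum.distrib scaleR_sum_right)

lemma bounded_linear_matrix_complex: "bounded_linear ((*v) (A :: complex ^ 'm::finite ^ 'k::finite))"
  using linear_matrix_complex linear_conv_bounded_linear by blast

lemma inj_matrix_iff_det: "inj ((*v) (A :: complex ^ 'm ^ 'm::finite)) \<longleftrightarrow> det A \<noteq> 0"
  by (simp only: matrix_left_invertible_injective[symmetric] invertible_left_inverse[symmetric]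
      invertible_det_nz)

lemma bounded_linear_erase: "bounded_linear (erase B)"
proof -
  have "linear (erase B)"
    by (rule linearI) (simp_all add: vec_eq_iff erase_def)
  then show ?thesis using linear_conv_bounded_linear by blast
qed

text \<open>Flows \<open>\<Phi> b\<close> of the Hamiltonian vector fields of all coordinates, defined for all times and points,
with spatial Jacobian matrix \<open>J\<close>. The last assumption says that each \<open>\<Phi> b t\<close> is a Poisson map.\<close>

locale poisson_flows =
  fixes \<pi> :: "'c::finite coord_brackets"
    and M :: "(complex ^ 'c) set"
    and \<Phi> :: "'c \<Rightarrow> complex \<Rightarrow> complex ^ 'c \<Rightarrow> complex ^ 'c"
    and J :: "'c \<Rightarrow> complex \<Rightarrow> complex ^ 'c \<Rightarrow> complex ^ 'c ^ 'c"
  assumes skew: "\<pi> b c x = - \<pi> c b x"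
    and continuous_bracket: "continuous_on UNIV (\<pi> b c)"
    and flow_in: "x \<in> M \<Longrightarrow> \<Phi> b t x \<in> M"
    and flow_0: "\<Phi> b 0 x = x"
    and flow_inverse: "\<Phi> b (- t) (\<Phi> b t x) = x"
    and flow_derivative: "((\<lambda>p. \<Phi> b (fst p) (snd p)) has_derivative
        (\<lambda>q. fst q *s row b (bracket_matrix \<pi> (\<Phi> b t x)) + J b t x *v snd q)) (at (t, x))"
    and continuous_Jacobian: "continuous_on UNIV (\<lambda>p. J b (fst p) (snd p))"
    and flow_poisson:
      "J b t x ** bracket_matrix \<pi> x ** transpose (J b t x) = bracket_matrix \<pi> (\<Phi> b t x)"
begin

abbreviation D :: "complex ^ 'c \<Rightarrow> (complex ^ 'c) set" where
  "D x \<equiv> range ((*v) (bracket_matrix \<pi> x))"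

lemma ham_distribution_eq_D: "ham_distribution \<pi> N = D"
  by (rule ext, rule ham_distribution_eq_range, rule skew)

lemma flow_derivative_space: "(\<Phi> b t has_derivative (*v) (J b t x)) (at x)"
proof -
  have "((\<lambda>y. (t, y)) has_derivative (\<lambda>v. (0, v))) (at x)"
    by (auto intro!: derivative_eq_intros)
  from has_derivative_compose[OF this flow_derivative]
  show ?thesis by simp
qed

lemma flow_derivative_time:
  "((\<lambda>t. \<Phi> b t x) has_derivative (\<lambda>s. s *s row b (bracket_matrix \<pi> (\<Phi> b t x)))) (at t)"
proof -
  have "((\<lambda>t. (t, x)) has_derivative (\<lambda>v. (v, 0))) (at t)"
    by (auto intro!: derivative_eq_intros)
  from has_derivative_compose[OF this flow_derivative]
  show ?thesis by simp
qed

lemma Jacobian_0: "J b 0 x = mat 1"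
proof -
  have "(\<Phi> b 0 has_derivative (\<lambda>v. v)) (at x)"
    unfolding flow_0[abs_def] by simp
  from has_derivative_unique[OF flow_derivative_space this]
  show ?thesis unfolding matrix_eq by (simp add: fun_eq_iff)
qed

lemma Jacobian_inverse: "J b (- t) (\<Phi> b t x) ** J b t x = mat 1"
proof -
  have "((\<lambda>x. \<Phi> b (- t) (\<Phi> b t x)) has_derivative (\<lambda>v. J b (- t) (\<Phi> b t x) *v (J b t x *v v))) (at x)"
    by (rule has_derivative_compose[OF flow_derivative_space flow_derivative_space])
  moreover have "((\<lambda>x. \<Phi> b (- t) (\<Phi> b t x)) has_derivative (\<lambda>v. v)) (at x)"
    unfolding flow_inverse by simp
  ultimately have "(\<lambda>v. J b (- t) (\<Phi> b t x) *v (J b t x *v v)) = (\<lambda>v. v)"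
    by (rule has_derivative_unique)
  then show ?thesis unfolding matrix_eq by (simp add: fun_eq_iff matrix_vector_mul_assoc)
qed

lemma inj_Jacobian: "inj ((*v) (J b t x))"
  by (rule matrix_left_invertible_injective[THEN iffD1, OF exI, OF Jacobian_inverse])

text \<open>Poisson maps carry the distribution to itself, since \<open>J\<close> and its transpose are onto.\<close>

lemma flow_D: "(*v) (J b t x) ` D x = D (\<Phi> b t x)"
proof -
  let ?J = "J b t x" and ?P = "bracket_matrix \<pi> x"
  let ?T = "transpose ?J" and ?T' = "transpose (J b (- t) (\<Phi> b t x))"
  have "?T ** ?T' = mat 1"
    by (simp add: Jacobian_inverse transpose_mat flip: matrix_transpose_mul)
  then have T: "?T *v (?T' *v u) = u" for u
    by (simp only: matrix_vector_mul_assoc matrix_vector_mul_lid)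
  have P: "bracket_matrix \<pi> (\<Phi> b t x) *v u = ?J *v (?P *v (?T *v u))" for u
    by (simp only: matrix_vector_mul_assoc matrix_mul_assoc flip: flow_poisson)
  show ?thesis
  proof (intro subset_antisym subsetI)
    fix y assume "y \<in> (*v) ?J ` D x"
    then obtain u where "y = ?J *v (?P *v u)" by blast
    then have "y = bracket_matrix \<pi> (\<Phi> b t x) *v (?T' *v u)" by (simp only: P T)
    then show "y \<in> D (\<Phi> b t x)" by (rule range_eqI)
  next
    fix y assume "y \<in> D (\<Phi> b t x)"
    then obtain u where "y = ?J *v (?P *v (?T *v u))" using P by blast
    then show "y \<in> (*v) ?J ` D x" by blast
  qed
qed

lemma dim_flow_D: "vec.dim (D (\<Phi> b t x)) = vec.dim (D x)"
  using vec.dim_image_eq[OF matrix_vector_mul_linear_gen inj_on_subset[OF inj_Jacobian subset_UNIV],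
      of b t x "D x"]
  unfolding flow_D .

inductive_set orbit :: "complex ^ 'c \<Rightarrow> (complex ^ 'c) set" for x where
  orbit_refl: "x \<in> orbit x"
| orbit_step: "y \<in> orbit x \<Longrightarrow> \<Phi> b t y \<in> orbit x"

lemma orbit_trans: "z \<in> orbit y \<Longrightarrow> y \<in> orbit x \<Longrightarrow> z \<in> orbit x"
  by (induction rule: orbit.induct) (auto intro: orbit_step)

lemma orbit_sym: "y \<in> orbit x \<Longrightarrow> x \<in> orbit y"
proof (induction rule: orbit.induct)
  case (orbit_step y b t)
  have "y \<in> orbit (\<Phi> b t y)"
    using orbit.orbit_step[OF orbit_refl, of b "- t" "\<Phi> b t y"] by (simp add: flow_inverse)
  then show ?case using orbit_step orbit_trans by blast
qed (rule orbit_refl)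

lemma orbit_eq: "y \<in> orbit x \<Longrightarrow> orbit y = orbit x"
  using orbit_trans orbit_sym by blast

lemma dim_orbit: "y \<in> orbit x \<Longrightarrow> vec.dim (D y) = vec.dim (D x)"
  by (induction rule: orbit.induct) (auto simp: dim_flow_D)

lemma orbit_subset: "x \<in> M \<Longrightarrow> orbit x \<subseteq> M"
proof
  show "y \<in> M" if "x \<in> M" "y \<in> orbit x" for y
    using that(2,1) by (induction rule: orbit.induct) (auto intro: flow_in)
qed

text \<open>The coordinates of \<open>z\<close> in \<open>B\<close> are the times for which the flows run, the others displace the starting
point. Restricted to \<open>coord_space B\<close> this parametrizes a neighbourhood of \<open>x\<close> in its orbit.\<close>

primrec plaque :: "complex ^ 'c \<Rightarrow> 'c set \<Rightarrow> 'c list \<Rightarrow> complex ^ 'c \<Rightarrow> complex ^ 'c" where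
  "plaque x B [] z = x + erase B z"
| "plaque x B (b # bs) z = \<Phi> b (z $ b) (plaque x B bs z)"

primrec plaque_Jacobian :: "complex ^ 'c \<Rightarrow> 'c set \<Rightarrow> 'c list \<Rightarrow> complex ^ 'c \<Rightarrow> complex ^ 'c ^ 'c" where
  "plaque_Jacobian x B [] z = (\<chi> c d. if c = d \<and> d \<notin> B then 1 else 0)"
| "plaque_Jacobian x B (b # bs) z =
     (\<chi> c d. if d = b then \<pi> b c (plaque x B (b # bs) z) else 0)
     + J b (z $ b) (plaque x B bs z) ** plaque_Jacobian x B bs z"

lemma erase_matrix: "(\<chi> c d. if c = d \<and> d \<notin> B then 1 else 0) *v v = erase B v"
proof -
  have "(\<Sum>d\<in>UNIV. (if c = d \<and> d \<notin> B then 1 else 0) * v $ d) = (\<Sum>d\<in>UNIV. if c = d then erase B v $ d else 0)" for c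
    by (intro sum.cong) (auto simp: erase_def)
  then show ?thesis
    by (simp add: vec_eq_iff matrix_vector_mult_def)
qed

lemma column_matrix_mult: "(\<chi> c d. if d = b then \<pi> b c y else 0) *v v = v $ b *s row b (bracket_matrix \<pi> y)"
proof -
  have "(\<Sum>d\<in>UNIV. (if d = b then \<pi> b c y else 0) * v $ d) = (\<Sum>d\<in>UNIV. if d = b then v $ b * \<pi> b c y else 0)" for c
    by (intro sum.cong) auto
  then show ?thesis
    by (simp add: vec_eq_iff matrix_vector_mult_def row_def bracket_matrix_def)
qed

lemma plaque_derivative: "(plaque x B bs has_derivative (*v) (plaque_Jacobian x B bs z)) (at z)"
proof (induction bs)
  case Nil
  have "((\<lambda>z. x + erase B z) has_derivative erase B) (at z)"
    using has_derivative_add[OF has_derivative_const bounded_linear_imp_has_derivative[OF bounded_linear_erase]]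
    by simp
  then show ?case by (simp add: erase_matrix[abs_def])
next
  case (Cons b bs)
  have "((\<lambda>z. (z $ b, plaque x B bs z)) has_derivative (\<lambda>v. (v $ b, plaque_Jacobian x B bs z *v v))) (at z)"
    by (intro has_derivative_Pair Cons bounded_linear_imp_has_derivative[OF bounded_linear_vec_nth])
  from has_derivative_compose[OF this flow_derivative]
  show ?case
    by (simp add: matrix_vector_mult_add_rdistrib column_matrix_mult matrix_vector_mul_assoc)
qed

lemma continuous_plaque: "continuous_on S (plaque x B bs)"
  by (intro continuous_at_imp_continuous_on ballI has_derivative_continuous[OF plaque_derivative])

lemma continuous_on_bracket_compose: "continuous_on S f \<Longrightarrow> continuous_on S (\<lambda>z. \<pi> b c (f z))"
  by (rule continuous_on_compose2[OF continuous_bracket]) auto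

lemma continuous_plaque_Jacobian: "continuous_on S (plaque_Jacobian x B bs)"
proof (induction bs)
  case (Cons b bs)
  have "continuous_on S (\<lambda>z. if d = b then \<pi> b c (plaque x B (b # bs) z) else 0)" for c d
    by (cases "d = b") (simp_all add: continuous_on_bracket_compose continuous_plaque del: plaque.simps)
  moreover have "continuous_on S (\<lambda>z. J b (z $ b) (plaque x B bs z))"
    using continuous_on_compose2[OF continuous_Jacobian[of b], of S "\<lambda>z. (z $ b, plaque x B bs z)"]
    by (simp add: continuous_plaque continuous_intros)
  ultimately show ?case
    by (simp only: plaque_Jacobian.simps)
      (intro continuous_intros continuous_on_matrix_mult_complex Cons)
qed simp

lemma plaque_0: "plaque x B bs 0 = x"
  by (induction bs) (auto simp: flow_0 erase_def vec_eq_iff)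

lemma plaque_Jacobian_0:
  assumes "distinct bs" "set bs \<subseteq> B"
  shows "plaque_Jacobian x B bs 0
    = (\<chi> c d. if d \<in> set bs then \<pi> d c x else if c = d \<and> d \<notin> B then 1 else 0)"
  using assms
  by (induction bs) (auto simp: Jacobian_0 plaque_0 flow_0 vec_eq_iff)

lemma row_in_D: "row b (bracket_matrix \<pi> x) \<in> D x"
  by (rule row_in_range, rule skew)

text \<open>The derivative of the composed flows with respect to the starting point.\<close>

primrec plaque_transport :: "complex ^ 'c \<Rightarrow> 'c set \<Rightarrow> 'c list \<Rightarrow> complex ^ 'c \<Rightarrow> complex ^ 'c ^ 'c" where
  "plaque_transport x B [] z = mat 1"
| "plaque_transport x B (b # bs) z = J b (z $ b) (plaque x B bs z) ** plaque_transport x B bs z"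

lemma matrix_mult_comp: "(*v) (A ** C) = (*v) A \<circ> (*v) C" for A C :: "complex ^ 'c ^ 'c"
  by (auto simp: matrix_vector_mul_assoc)

lemma inj_plaque_transport: "inj ((*v) (plaque_transport x B bs z))"
proof (induction bs)
  case (Cons b bs)
  then show ?case
    by (simp only: plaque_transport.simps matrix_mult_comp) (intro inj_compose inj_Jacobian)
qed (simp add: inj_on_def)

lemma plaque_transport_D:
  "(*v) (plaque_transport x B bs z) ` D (x + erase B z) = D (plaque x B bs z)"
proof (induction bs)
  case (Cons b bs)
  then show ?case
    by (simp only: plaque_transport.simps matrix_mult_comp image_comp[symmetric] flow_D plaque.simps)
qed simp

text \<open>Changing the times moves a point along the distribution; only the displacement of the starting
point, carried along by the flows, can leave it.\<close>

lemma plaque_tangency: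
  "plaque_Jacobian x B bs z *v v - plaque_transport x B bs z *v erase B v \<in> D (plaque x B bs z)"
proof (induction bs)
  case Nil
  show ?case
    using vec.subspace_0[OF subspace_range_mult] by (simp add: erase_matrix)
next
  case (Cons b bs)
  let ?J = "J b (z $ b) (plaque x B bs z)" and ?y = "plaque x B (b # bs) z"
  let ?w = "plaque_Jacobian x B bs z *v v - plaque_transport x B bs z *v erase B v"
  have "plaque_Jacobian x B (b # bs) z *v v - plaque_transport x B (b # bs) z *v erase B v
      = v $ b *s row b (bracket_matrix \<pi> ?y) + ?J *v ?w"
    by (simp add: matrix_vector_mult_add_rdistrib column_matrix_mult matrix_vector_mult_diff_distrib
        flip: matrix_vector_mul_assoc)
  moreover have "?J *v ?w \<in> D ?y"
    using imageI[OF Cons, of "(*v) ?J"] unfolding flow_D plaque.simps .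
  ultimately show ?case
    by (simp only:) (intro vec.subspace_add vec.subspace_scale subspace_range_mult row_in_D)
qed

lemma plaque_orbit: "z \<in> coord_space B \<Longrightarrow> plaque x B bs z \<in> orbit x"
proof (induction bs)
  case Nil
  then have "erase B z = 0" by (simp add: erase_eq_0_iff)
  then show ?case by (simp add: orbit_refl)
qed (simp add: orbit_step)

definition tangent_map :: "(complex ^ 'c \<Rightarrow> complex ^ 'c) \<Rightarrow> (complex ^ 'c) set \<Rightarrow> bool" where
  "tangent_map f A \<longleftrightarrow> open A \<and> (\<forall>w\<in>A. \<exists>f'. (f has_derivative f') (at w) \<and> range f' \<subseteq> D (f w))"

lemma tangent_map_continuous: "tangent_map f A \<Longrightarrow> continuous_on A f"
  unfolding tangent_map_def
  by (metis continuous_at_imp_continuous_on has_derivative_continuous)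

text \<open>The last clause is the uniqueness of plaques: a map that is tangent to the distribution, of the same
rank, and that meets a relatively open piece of the plaque stays in that piece for a while.\<close>

definition slice_chart ::
  "complex ^ 'c \<Rightarrow> 'c set \<Rightarrow> (complex ^ 'c \<Rightarrow> complex ^ 'c) \<Rightarrow> (complex ^ 'c \<Rightarrow> complex ^ 'c ^ 'c)
    \<Rightarrow> (complex ^ 'c) set \<Rightarrow> bool" where
  "slice_chart x B \<psi> K U \<longleftrightarrow> open U \<and> 0 \<in> U \<and> \<psi> 0 = x \<and> inj_on \<psi> U \<and>
     (\<forall>z\<in>U. (\<psi> has_derivative (*v) (K z)) (at z) \<and> inj ((*v) (K z))) \<and>
     (\<forall>z\<in>coord_space B \<inter> U. (*v) (K z) ` coord_space B = D (\<psi> z)) \<and>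
     (\<forall>z\<in>coord_space B. \<psi> z \<in> orbit x) \<and>
     (\<forall>f A w U'. tangent_map f A \<and> (\<forall>w\<in>A. vec.dim (D (f w)) = vec.dim (D x)) \<and> w \<in> A \<and>
        open U' \<and> U' \<subseteq> U \<and> f w \<in> \<psi> ` (coord_space B \<inter> U') \<longrightarrow>
        (\<exists>\<delta>>0. ball w \<delta> \<subseteq> A \<and> f ` ball w \<delta> \<subseteq> \<psi> ` (coord_space B \<inter> U')))"

text \<open>The chart comes from the inverse function theorem. For uniqueness, read a tangent map \<open>f\<close> in the
chart. By \<open>plaque_tangency\<close>, the derivative of its transversal coordinates lies in the distribution at
the displaced starting point. That point has the same rank as \<open>x\<close>, so the transversal directions form
a complement there and the derivative vanishes. Hence the transversal coordinates keep their value \<open>0\<close>.\<close>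

lemma slice_chart_exists: "\<exists>B \<psi> K U. slice_chart x B \<psi> K U"
proof -
  obtain B where B: "inj ((*v) (basis_completion \<pi> B x))" "vec.dim (D x) = card B"
    using basis_completion_exists[of \<pi> x, OF skew] by blast
  obtain bs where bs: "set bs = B" "distinct bs"
    using finite_distinct_list[of B] by auto
  \<comment> \<open>The derivative at \<open>0\<close> is the same for every enumeration of \<open>B\<close>.\<close>
  define \<psi> where "\<psi> = plaque x B bs"
  define K where "K = plaque_Jacobian x B bs"
  have dK: "(\<psi> has_derivative (*v) (K z)) (at z)" for z
    unfolding \<psi>_def K_def by (rule plaque_derivative)
  have "K 0 = basis_completion \<pi> B x"
    using plaque_Jacobian_0[of bs B x] bs
    unfolding K_def basis_completion_def by (simp add: vec_eq_iff)
  then obtain L where L: "L ** K 0 = mat 1"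
    using B(1) matrix_left_invertible_injective by metis
  have Bl: "blinfun_apply (Blinfun ((*v) A)) = (*v) A" for A :: "complex ^ 'c ^ 'c"
    by (rule bounded_linear_Blinfun_apply[OF bounded_linear_matrix_complex])
  have cont: "continuous_on UNIV (\<lambda>z. Blinfun ((*v) (K z)))"
    unfolding K_def
    by (rule continuous_on_blinfun_componentwise)
      (simp add: Bl matrix_vector_mult_def,
        intro continuous_intros continuous_plaque_Jacobian)
  have left: "Blinfun ((*v) L) o\<^sub>L Blinfun ((*v) (K 0)) = id_blinfun"
    by (rule blinfun_eqI) (simp add: Bl matrix_vector_mul_assoc L)
  have dKb: "(\<psi> has_derivative blinfun_apply (Blinfun ((*v) (K z)))) (at z)" for z
    unfolding Bl by (rule dK)
  obtain U V g where U: "open U" "0 \<in> U" "open V" "homeomorphism U V \<psi> g"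
    and g: "\<And>y. y \<in> V \<Longrightarrow> (g has_derivative inv_into UNIV ((*v) (K (g y)))) (at y)"
    and bij: "\<And>y. y \<in> V \<Longrightarrow> bij ((*v) (K (g y)))"
    by (rule inverse_function_theorem[OF open_UNIV dKb cont UNIV_I left], rule that) (simp_all add: Bl)
  define g' where "g' y = inv_into UNIV ((*v) (K (g y)))" for y
  note g = g[folded g'_def]
  have injK: "inj ((*v) (K z))" if "z \<in> U" for z
    using bij[of "\<psi> z"] that U(4) by (auto simp: homeomorphism_def bij_def)
  have imK: "(*v) (K z) ` coord_space B = D (\<psi> z)" if z: "z \<in> U" "z \<in> coord_space B" for z
  proof -
    have "K z *v v \<in> D (\<psi> z)" if "v \<in> coord_space B" for v
      using that plaque_tangency[of x B bs z v] erase_eq_0_iff[of B v] by (simp add: \<psi>_def K_def)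
    moreover have "vec.dim ((*v) (K z) ` coord_space B) = card B"
      using vec.dim_image_eq[OF matrix_vector_mul_linear_gen inj_on_subset[OF injK[OF z(1)] subset_UNIV]]
        dim_coord_space by metis
    moreover have "vec.dim (D (\<psi> z)) = card B"
      using dim_orbit plaque_orbit[OF z(2)] B(2) unfolding \<psi>_def by metis
    ultimately show ?thesis
      by (intro vec.subspace_dim_equal vec.subspace_image subspace_range_mult subspace_coord_space) auto
  qed
  have unique: "\<exists>\<delta>>0. ball w0 \<delta> \<subseteq> A \<and> f ` ball w0 \<delta> \<subseteq> \<psi> ` (coord_space B \<inter> U')"
    if f: "tangent_map f A" and rank: "\<forall>w\<in>A. vec.dim (D (f w)) = vec.dim (D x)"
      and w0: "w0 \<in> A" "f w0 \<in> \<psi> ` (coord_space B \<inter> U')" and U': "open U'" "U' \<subseteq> U"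
    for f A w0 U'
  proof -
    define A1 where "A1 = A \<inter> f -` V"
    define z where "z = g \<circ> f"
    have A: "open A" using f by (simp add: tangent_map_def)
    have A1: "open A1"
      unfolding A1_def using f A U(3) tangent_map_continuous by (intro continuous_open_preimage)
    have gV: "continuous_on V g" "\<And>y. y \<in> V \<Longrightarrow> \<psi> (g y) = y" "\<And>z. z \<in> U \<Longrightarrow> g (\<psi> z) = z"
      "\<And>y. y \<in> V \<Longrightarrow> g y \<in> U" "\<And>z. z \<in> U \<Longrightarrow> \<psi> z \<in> V"
      using U(4) by (auto simp: homeomorphism_def)
    have cz: "continuous_on A1 z"
      unfolding z_def A1_def
      by (intro continuous_on_compose continuous_on_subset[OF gV(1)]
          continuous_on_subset[OF tangent_map_continuous[OF f]]) auto
    \<comment> \<open>Where the chart coordinates lie in \<open>U'\<close> and the transversal directions are still a complement.\<close>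
  define A2 where "A2 = (A1 \<inter> z -` U') \<inter> (A1 \<inter> (\<lambda>w. det (basis_completion \<pi> B (x + erase B (z w)))) -` (- {0}))"
    have cbc: "continuous_on A1 (\<lambda>w. basis_completion \<pi> B (x + erase B (z w)))"
    proof -
      have "continuous_on A1 (\<lambda>w. x + erase B (z w))"
        by (intro continuous_intros bounded_linear.continuous_on[OF bounded_linear_erase] cz)
      then have "continuous_on A1 (\<lambda>w. if d \<in> B then \<pi> d c (x + erase B (z w)) else if c = d then 1 else 0)" for c d
        by (cases "d \<in> B") (simp_all add: continuous_on_bracket_compose)
      then show ?thesis unfolding basis_completion_def by (intro continuous_intros)
    qed
    have A2: "open A2"
      unfolding A2_def
      by (intro open_Int continuous_open_preimage cz A1 U'(1) continuous_on_det_complex cbc open_Compl) auto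
    obtain z0 where z0: "z0 \<in> coord_space B" "z0 \<in> U'" "f w0 = \<psi> z0" using w0(2) by auto
    have zw0: "z w0 = z0" using z0 U'(2) gV(3) by (auto simp: z_def)
    have "w0 \<in> A2"
      using zw0 z0 U'(2) gV(5) w0(1) erase_eq_0_iff[of B z0] B(1)
      by (auto simp: A2_def A1_def inj_matrix_iff_det)
    then obtain \<delta> where \<delta>: "\<delta> > 0" "ball w0 \<delta> \<subseteq> A2"
      using A2 open_contains_ball by blast
    have "\<exists>c. \<forall>w\<in>ball w0 \<delta>. erase B (z w) = c"
    proof (rule has_derivative_zero_constant[OF convex_ball])
      fix w assume "w \<in> ball w0 \<delta>"
      then have w: "w \<in> A" "f w \<in> V" "z w \<in> U" "inj ((*v) (basis_completion \<pi> B (x + erase B (z w))))"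
        using \<delta>(2) U'(2) by (auto simp: A2_def A1_def inj_matrix_iff_det)
      obtain f' where f': "(f has_derivative f') (at w)" "range f' \<subseteq> D (f w)"
        using f w(1) by (auto simp: tangent_map_def)
      have dz: "(z has_derivative (\<lambda>v. g' (f w) (f' v))) (at w)"
        unfolding z_def comp_def by (rule has_derivative_compose[OF f'(1) g[OF w(2)]])
      have "((\<lambda>w. \<psi> (z w)) has_derivative (\<lambda>v. K (z w) *v g' (f w) (f' v))) (at w)"
        by (rule has_derivative_compose[OF dz dK])
      moreover have "((\<lambda>w. \<psi> (z w)) has_derivative f') (at w)"
        by (rule has_derivative_transform_within_open[OF f'(1) A1])
          (use w in \<open>auto simp: A1_def z_def gV\<close>)
      ultimately have "(\<lambda>v. K (z w) *v g' (f w) (f' v)) = f'"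
        by (rule has_derivative_unique)
      then have f'_eq: "f' v = K (z w) *v g' (f w) (f' v)" for v by metis
      have fw: "f w = \<psi> (z w)" using gV(2) w(2) by (simp add: z_def)
      define C where "C = plaque_transport x B bs (z w)"
      have C: "inj ((*v) C)" "(*v) C ` D (x + erase B (z w)) = D (\<psi> (z w))"
        "K (z w) *v v - C *v erase B v \<in> D (\<psi> (z w))" for v
        unfolding C_def \<psi>_def K_def
        by (rule inj_plaque_transport plaque_transport_D plaque_tangency)+
      have dim: "vec.dim (D (x + erase B (z w))) = card B"
        using vec.dim_image_eq[OF matrix_vector_mul_linear_gen inj_on_subset[OF C(1) subset_UNIV]]
          C(2) rank w(1) B(2) fw by metis
      have "erase B (g' (f w) (f' v)) = 0" for v
      proof -
        let ?u = "g' (f w) (f' v)"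
        have "K (z w) *v ?u \<in> D (\<psi> (z w))" using f'(2) fw f'_eq by (metis rangeI subsetD)
        from vec.subspace_diff[OF subspace_range_mult this C(3)[of ?u]]
        have "C *v erase B ?u \<in> (*v) C ` D (x + erase B (z w))" by (simp add: C(2))
        then have "erase B ?u \<in> D (x + erase B (z w))" using C(1) by (metis imageE injD)
        then show ?thesis
          using complement_transversal[of \<pi> "x + erase B (z w)", OF skew w(4) dim] by blast
      qed
      then have "((\<lambda>w. erase B (z w)) has_derivative (\<lambda>v. 0)) (at w)"
        using bounded_linear.has_derivative[OF bounded_linear_erase[of B] dz] by simp
      then show "((\<lambda>w. erase B (z w)) has_derivative (\<lambda>v. 0)) (at w within ball w0 \<delta>)"
        by (rule has_derivative_at_withinI)
    qed
    then have "erase B (z w) = erase B (z w0)" if "w \<in> ball w0 \<delta>" for w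
      using that \<delta>(1) by (metis centre_in_ball)
    then have "z w \<in> coord_space B" if "w \<in> ball w0 \<delta>" for w
      using that zw0 z0(1) erase_eq_0_iff by metis
    moreover have "f w = \<psi> (z w)" "z w \<in> U'" if "w \<in> ball w0 \<delta>" for w
      using that \<delta>(2) gV(2) by (auto simp: A2_def A1_def z_def)
    ultimately have "f ` ball w0 \<delta> \<subseteq> \<psi> ` (coord_space B \<inter> U')" by blast
    moreover have "ball w0 \<delta> \<subseteq> A" using \<delta>(2) by (auto simp: A2_def A1_def)
    ultimately show ?thesis using \<delta>(1) by blast
  qed
  have "slice_chart x B \<psi> K U"
    unfolding slice_chart_def
  proof (intro conjI allI impI ballI)
    show "open U" "0 \<in> U" by (fact U)+
    show "\<psi> 0 = x" unfolding \<psi>_def by (rule plaque_0)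
    show "inj_on \<psi> U" using U(4) by (metis homeomorphism_apply1 inj_onI)
    show "\<psi> z \<in> orbit x" if "z \<in> coord_space B" for z
      using that unfolding \<psi>_def by (rule plaque_orbit)
    show "(\<psi> has_derivative (*v) (K z)) (at z)" for z by (rule dK)
    show "inj ((*v) (K z))" if "z \<in> U" for z by (rule injK[OF that])
    show "(*v) (K z) ` coord_space B = D (\<psi> z)" if "z \<in> coord_space B \<inter> U" for z
      using imK that by blast
  qed (use unique in blast)
  then show ?thesis by blast
qed

section \<open>Orbits as symplectic leaves\<close>

text \<open>The final topology with respect to all tangent maps into the orbit. All such maps are continuous
by construction, and uniqueness of plaques makes the plaques open.\<close>

definition orbit_topology :: "complex ^ 'c \<Rightarrow> (complex ^ 'c) topology" where
  "orbit_topology x = topology (\<lambda>V. V \<subseteq> orbit x \<and>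
     (\<forall>f A. tangent_map f A \<and> f ` A \<subseteq> orbit x \<longrightarrow> open (A \<inter> f -` V)))"

lemma openin_orbit_topology:
  "openin (orbit_topology x) V \<longleftrightarrow> V \<subseteq> orbit x \<and>
     (\<forall>f A. tangent_map f A \<and> f ` A \<subseteq> orbit x \<longrightarrow> open (A \<inter> f -` V))"
proof -
  have "istopology (\<lambda>V. V \<subseteq> orbit x \<and>
     (\<forall>f A. tangent_map f A \<and> f ` A \<subseteq> orbit x \<longrightarrow> open (A \<inter> f -` V)))" (is "istopology ?P")
    unfolding istopology_def
  proof (rule conjI; intro allI impI)
    fix V W assume VW: "?P V" "?P W"
    have "A \<inter> f -` (V \<inter> W) = (A \<inter> f -` V) \<inter> (A \<inter> f -` W)" for f :: "complex ^ 'c \<Rightarrow> complex ^ 'c" and A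
      by blast
    then show "?P (V \<inter> W)" using VW by auto
  next
    fix \<V> assume V: "\<forall>V\<in>\<V>. ?P V"
    show "?P (\<Union>\<V>)"
    proof (intro conjI allI impI)
      show "\<Union>\<V> \<subseteq> orbit x" using V by blast
      fix f A assume "tangent_map f A \<and> f ` A \<subseteq> orbit x"
      then have "open (\<Union>V\<in>\<V>. A \<inter> f -` V)" using V by blast
      moreover have "A \<inter> f -` (\<Union>\<V>) = (\<Union>V\<in>\<V>. A \<inter> f -` V)" by blast
      ultimately show "open (A \<inter> f -` (\<Union>\<V>))" by (simp only:)
    qed
  qed
  then show ?thesis
    unfolding orbit_topology_def by (simp add: topology_inverse')
qed

lemma topspace_orbit_topology: "topspace (orbit_topology x) = orbit x"
proof
  show "topspace (orbit_topology x) \<subseteq> orbit x"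
    using openin_topspace openin_orbit_topology by blast
  have "A \<inter> f -` orbit x = A" if "f ` A \<subseteq> orbit x" for f :: "complex ^ 'c \<Rightarrow> complex ^ 'c" and A
    using that by blast
  then have "openin (orbit_topology x) (orbit x)"
    unfolding openin_orbit_topology tangent_map_def by simp
  then show "orbit x \<subseteq> topspace (orbit_topology x)"
    by (rule openin_subset)
qed

lemma coordinate_projection:
  obtains P :: "complex ^ 'c \<Rightarrow> complex ^ 'c"
  where "bounded_linear P" "range P \<subseteq> coord_space B" "\<And>v. v \<in> coord_space B \<Longrightarrow> P v = v"
proof -
  have "bounded_linear (\<lambda>v. v - erase B v)"
    by (intro bounded_linear_sub bounded_linear_ident bounded_linear_erase)
  then show ?thesis
    by (rule that) (auto simp: coord_space_def erase_def vec_eq_iff)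
qed

text \<open>Charts of integral manifolds live on subspaces; composing with a projection turns them into tangent
maps on open sets.\<close>

lemma tangent_map_compose:
  assumes P: "bounded_linear P" "range P \<subseteq> S" and U: "open U"
    and d: "\<And>z. z \<in> S \<inter> U \<Longrightarrow>
      \<exists>\<psi>'. (\<psi> has_derivative \<psi>') (at z within (S \<inter> U)) \<and> \<psi>' ` S \<subseteq> D (\<psi> z)"
  shows "tangent_map (\<lambda>w. \<psi> (P w)) (P -` U)"
  unfolding tangent_map_def
proof (intro conjI ballI)
  show oU: "open (P -` U)"
    using P(1) U by (intro open_vimage linear_continuous_on)
  fix w assume w: "w \<in> P -` U"
  then obtain \<psi>' where \<psi>': "(\<psi> has_derivative \<psi>') (at (P w) within (S \<inter> U))" "\<psi>' ` S \<subseteq> D (\<psi> (P w))"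
    using d[of "P w"] P(2) by blast
  have "((\<lambda>w. \<psi> (P w)) has_derivative (\<lambda>v. \<psi>' (P v))) (at w within (P -` U))"
    by (rule has_derivative_in_compose[OF bounded_linear_imp_has_derivative[OF P(1)]
          has_derivative_subset[OF \<psi>'(1)]]) (use P(2) in auto)
  then have "((\<lambda>w. \<psi> (P w)) has_derivative (\<lambda>v. \<psi>' (P v))) (at w)"
    using at_within_open[OF w oU] by simp
  then show "\<exists>f'. ((\<lambda>w. \<psi> (P w)) has_derivative f') (at w) \<and> range f' \<subseteq> D (\<psi> (P w))"
    using \<psi>'(2) P(2) by (intro exI conjI) blast+
qed

lemma slice_chart_unique:
  assumes "slice_chart x B \<psi> K U" and "tangent_map f A" "\<forall>w\<in>A. vec.dim (D (f w)) = vec.dim (D x)"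
    and "w \<in> A" "open U'" "U' \<subseteq> U" "f w \<in> \<psi> ` (coord_space B \<inter> U')"
  shows "\<exists>\<delta>>0. ball w \<delta> \<subseteq> A \<and> f ` ball w \<delta> \<subseteq> \<psi> ` (coord_space B \<inter> U')"
proof -
  have "\<forall>f A w U'. tangent_map f A \<and> (\<forall>w\<in>A. vec.dim (D (f w)) = vec.dim (D x)) \<and> w \<in> A \<and>
        open U' \<and> U' \<subseteq> U \<and> f w \<in> \<psi> ` (coord_space B \<inter> U') \<longrightarrow>
        (\<exists>\<delta>>0. ball w \<delta> \<subseteq> A \<and> f ` ball w \<delta> \<subseteq> \<psi> ` (coord_space B \<inter> U'))"
    using assms(1) unfolding slice_chart_def by (elim conjE)
  then show ?thesis
    by (elim allE[of _ f] allE[of _ A] allE[of _ w] allE[of _ U'] mp) (intro conjI assms(2-))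
qed

text \<open>The plaque is open in the orbit topology by uniqueness of plaques, applied to every tangent map.
The same argument on smaller open sets shows that the chart is an open map.\<close>

lemma orbit_chart:
  assumes y: "y \<in> orbit x"
  shows "\<exists>S W \<phi>. integral_chart D (orbit_topology x) S W \<phi> \<and> y \<in> \<phi> ` W"
proof -
  obtain B \<psi> K U where chart: "slice_chart y B \<psi> K U" using slice_chart_exists[of y] by blast
  then have U: "open U" "0 \<in> U" "\<psi> 0 = y" "inj_on \<psi> U"
    and der: "\<And>z. z \<in> U \<Longrightarrow> (\<psi> has_derivative (*v) (K z)) (at z)"
    and inj: "\<And>z. z \<in> U \<Longrightarrow> inj ((*v) (K z))"
    and im: "\<And>z. z \<in> coord_space B \<inter> U \<Longrightarrow> (*v) (K z) ` coord_space B = D (\<psi> z)"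
    and orb: "\<And>z. z \<in> coord_space B \<Longrightarrow> \<psi> z \<in> orbit y"
    by (simp_all only: slice_chart_def)
  define S where "S = (coord_space B :: (complex ^ 'c) set)"
  let ?T = "orbit_topology x"
  have orbx: "\<psi> z \<in> orbit x" if "z \<in> S" for z
    using orb that orbit_eq[OF y] unfolding S_def by blast
  have open_plaque: "openin ?T (\<psi> ` (S \<inter> U'))" if U': "open U'" "U' \<subseteq> U" for U'
    unfolding openin_orbit_topology
  proof (intro conjI allI impI)
    show "\<psi> ` (S \<inter> U') \<subseteq> orbit x" using orbx by blast
    fix f A assume f: "tangent_map f A \<and> f ` A \<subseteq> orbit x"
    have dims: "\<forall>w\<in>A. vec.dim (D (f w)) = vec.dim (D y)"
      using f dim_orbit[of _ x] dim_orbit[OF y] by (metis image_subset_iff)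
    show "open (A \<inter> f -` \<psi> ` (S \<inter> U'))"
      unfolding open_contains_ball
    proof
      fix w assume "w \<in> A \<inter> f -` \<psi> ` (S \<inter> U')"
      then obtain \<delta> where "\<delta> > 0" "ball w \<delta> \<subseteq> A" "f ` ball w \<delta> \<subseteq> \<psi> ` (S \<inter> U')"
        using slice_chart_unique[OF chart, of f A w U'] f dims U' unfolding S_def by auto
      then show "\<exists>\<delta>>0. ball w \<delta> \<subseteq> A \<inter> f -` \<psi> ` (S \<inter> U')"
        by (intro exI[of _ \<delta>]) blast
    qed
  qed
  define W where "W = S \<inter> U"
  have "integral_chart D ?T S W \<psi>"
    unfolding integral_chart_def
  proof (intro conjI ballI)
    show "vec.subspace S" unfolding S_def by (rule subspace_coord_space)
    show "openin (top_of_set S) W" unfolding W_def using U(1) by (rule openin_open_Int)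
    show oT: "openin ?T (\<psi> ` W)" unfolding W_def using U(1) by (intro open_plaque) auto
    show "homeomorphic_map (top_of_set W) (subtopology ?T (\<psi> ` W)) \<psi>"
    proof (rule bijective_open_imp_homeomorphic_map)
      obtain P :: "complex ^ 'c \<Rightarrow> complex ^ 'c" where P: "bounded_linear P" "range P \<subseteq> S"
        "\<And>v. v \<in> S \<Longrightarrow> P v = v"
        by (rule coordinate_projection[where B=B, folded S_def], rule that)
      have tm: "tangent_map (\<lambda>w. \<psi> (P w)) (P -` U)"
      proof (rule tangent_map_compose[OF P(1,2) U(1)])
        fix z assume "z \<in> S \<inter> U"
        then have K: "(\<psi> has_derivative (*v) (K z)) (at z)" "(*v) (K z) ` S = D (\<psi> z)"
          using der[of z] im[of z] unfolding S_def by simp_all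
        show "\<exists>\<psi>'. (\<psi> has_derivative \<psi>') (at z within (S \<inter> U)) \<and> \<psi>' ` S \<subseteq> D (\<psi> z)"
          using has_derivative_at_withinI[OF K(1)] K(2) by (intro exI[of _ "(*v) (K z)"]) simp
      qed
      have into: "(\<lambda>w. \<psi> (P w)) ` (P -` U) \<subseteq> orbit x" using orbx P(2) by blast
      show "continuous_map (top_of_set W) (subtopology ?T (\<psi> ` W)) \<psi>"
        unfolding continuous_map_in_subtopology
      proof
        show "continuous_map (top_of_set W) ?T \<psi>"
          unfolding continuous_map_def topspace_orbit_topology
        proof (intro conjI allI impI)
          show "\<psi> \<in> topspace (top_of_set W) \<rightarrow> orbit x" using orbx by (auto simp: W_def)
          fix V assume "openin ?T V"
          then have "open (P -` U \<inter> (\<lambda>w. \<psi> (P w)) -` V)"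
            using tm into unfolding openin_orbit_topology by blast
          then have "openin (top_of_set W) (W \<inter> (P -` U \<inter> (\<lambda>w. \<psi> (P w)) -` V))"
            by (rule openin_open_Int)
          moreover have "W \<inter> (P -` U \<inter> (\<lambda>w. \<psi> (P w)) -` V) = {z \<in> topspace (top_of_set W). \<psi> z \<in> V}"
            using P(3) by (auto simp: W_def)
          ultimately show "openin (top_of_set W) {z \<in> topspace (top_of_set W). \<psi> z \<in> V}" by simp
        qed
      qed auto
      show "open_map (top_of_set W) (subtopology ?T (\<psi> ` W)) \<psi>"
        unfolding open_map_def
      proof (intro allI impI)
        fix W' assume "openin (top_of_set W) W'"
        then obtain U1 where "open U1" "W' = W \<inter> U1" by (auto simp: openin_open)
        then have "openin ?T (\<psi> ` W')"
          using open_plaque[of "U \<inter> U1"] U(1) by (auto simp: W_def Int_assoc)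
        then show "openin (subtopology ?T (\<psi> ` W)) (\<psi> ` W')"
          using \<open>W' = W \<inter> U1\<close> by (auto simp: openin_subtopology)
      qed
      show "\<psi> ` topspace (top_of_set W) = topspace (subtopology ?T (\<psi> ` W))"
        using openin_subset[OF oT] by auto
      show "inj_on \<psi> (topspace (top_of_set W))"
        using inj_on_subset[OF U(4)] by (auto simp: W_def)
    qed
    fix w assume "w \<in> W"
    then have K: "(\<psi> has_derivative (*v) (K w)) (at w)" "inj ((*v) (K w))" "(*v) (K w) ` S = D (\<psi> w)"
      using der[of w] inj[of w] im[of w] unfolding W_def S_def by simp_all
    show "\<exists>\<phi>'. (\<psi> has_derivative \<phi>') (at w within W) \<and>
        Vector_Spaces.linear (*s) (*s) \<phi>' \<and> inj_on \<phi>' S \<and> \<phi>' ` S = D (\<psi> w)"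
      using has_derivative_at_withinI[OF K(1)] inj_on_subset[OF K(2) subset_UNIV] K(3)
      by (intro exI[of _ "(*v) (K w)"]) simp
  qed
  moreover have "y \<in> \<psi> ` W" using U(2,3) vec.subspace_0[OF subspace_coord_space]
    unfolding W_def S_def by blast
  ultimately show ?thesis by blast
qed

text \<open>A flow line, with complex time read off a coordinate of \<open>complex ^ 'c\<close>, is a tangent map on a
connected space, so no open partition of the orbit can separate its points.\<close>

lemma connected_orbit_topology: "connected_space (orbit_topology x)"
  unfolding connected_space_def topspace_orbit_topology
proof
  let ?T = "orbit_topology x"
  assume "\<exists>E1 E2. openin ?T E1 \<and> openin ?T E2 \<and> orbit x \<subseteq> E1 \<union> E2 \<and> E1 \<inter> E2 = {} \<and> E1 \<noteq> {} \<and> E2 \<noteq> {}"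
  then obtain E1 E2 where E: "openin ?T E1" "openin ?T E2" "orbit x \<subseteq> E1 \<union> E2" "E1 \<inter> E2 = {}" "E1 \<noteq> {}" "E2 \<noteq> {}"
    by blast
  obtain y where y: "y \<in> E1" using E(5) by blast
  have yx: "y \<in> orbit x" using y E(1) openin_orbit_topology by blast
  have "z \<in> E1" if "z \<in> orbit y" for z
    using that
  proof (induction rule: orbit.induct)
    case (orbit_step z b t)
    define f where "f w = \<Phi> b (w $ b) z" for w :: "complex ^ 'c"
    have zx: "z \<in> orbit x" using orbit_step(1) orbit_eq[OF yx] by blast
    have "tangent_map f UNIV"
      unfolding tangent_map_def
    proof (intro conjI ballI exI)
      fix w
      show "(f has_derivative (\<lambda>v. v $ b *s row b (bracket_matrix \<pi> (f w)))) (at w)"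
        unfolding f_def
        by (rule has_derivative_compose[OF bounded_linear_imp_has_derivative[OF bounded_linear_vec_nth]
              flow_derivative_time])
      show "range (\<lambda>v. v $ b *s row b (bracket_matrix \<pi> (f w))) \<subseteq> D (f w)"
        using vec.subspace_scale[OF subspace_range_mult row_in_D] by blast
    qed simp
    moreover have fx: "f ` UNIV \<subseteq> orbit x"
      using zx orbit.orbit_step by (auto simp: f_def)
    ultimately have "open (f -` E1)" "open (f -` E2)"
      using E(1,2) unfolding openin_orbit_topology by (metis Int_UNIV_left)+
    moreover have "f -` E1 \<inter> f -` E2 = {}" "f -` E1 \<union> f -` E2 = UNIV" using E(3,4) fx by blast+
    moreover have "0 \<in> f -` E1" using orbit_step by (simp add: f_def flow_0)
    ultimately have "f -` E2 = {}"
      using connectedD[OF connected_UNIV, of "f -` E1" "f -` E2"] by auto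
    then have "f (\<chi> c. t) \<in> E1" using E(3) fx by blast
    then show ?case by (simp add: f_def)
  qed (rule y)
  then have "orbit x \<subseteq> E1" using orbit_eq[OF yx] by blast
  moreover have "E2 \<subseteq> orbit x" using E(2) openin_orbit_topology by blast
  ultimately show False using E(4,6) by blast
qed

lemma orbit_integral_manifold:
  assumes "x \<in> M"
  shows "connected_integral_manifold D M (orbit_topology x)"
  unfolding connected_integral_manifold_def topspace_orbit_topology
proof (intro conjI ballI)
  show "orbit x \<noteq> {}" using orbit_refl by (metis empty_iff)
  show "orbit x \<subseteq> M" by (rule orbit_subset[OF assms])
  show "connected_space (orbit_topology x)" by (rule connected_orbit_topology)
  show "\<exists>S W \<phi>. integral_chart D (orbit_topology x) S W \<phi> \<and> y \<in> \<phi> ` W" if "y \<in> orbit x" for y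
    by (rule orbit_chart[OF that])
qed

lemma scaleR_eq_smult: "c *\<^sub>R v = of_real c *s v" for v :: "complex ^ 'c"
  by (simp add: vec_eq_iff scaleR_conv_of_real[where 'a=complex])

text \<open>An integral chart has constant rank, so uniqueness of plaques applies to it.\<close>

lemma integral_chart_local_orbit:
  assumes chart: "integral_chart D T S W \<psi>" and w0: "w0 \<in> W"
  shows "\<exists>N. openin T N \<and> \<psi> w0 \<in> N \<and> N \<subseteq> orbit (\<psi> w0)"
proof -
  have S: "vec.subspace S" and "openin (top_of_set S) W" and oT: "openin T (\<psi> ` W)"
    and homeo: "homeomorphic_map (top_of_set W) (subtopology T (\<psi> ` W)) \<psi>"
    and der: "\<And>w. w \<in> W \<Longrightarrow> \<exists>\<phi>'. (\<psi> has_derivative \<phi>') (at w within W) \<and>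
        Vector_Spaces.linear (*s) (*s) \<phi>' \<and> inj_on \<phi>' S \<and> \<phi>' ` S = D (\<psi> w)"
    using chart unfolding integral_chart_def by auto
  then obtain U where U: "open U" "W = S \<inter> U" by (auto simp: openin_open)
  have "subspace S"
    using S by (auto simp: subspace_def vec.subspace_def scaleR_eq_smult)
  then obtain P where "P ` UNIV \<subseteq> S" "linear P" "\<forall>v\<in>S. P v = v"
    using linear_exists_left_inverse_on[OF linear_ident, of S] by auto
  then have P: "bounded_linear P" "range P \<subseteq> S" "\<And>v. v \<in> S \<Longrightarrow> P v = v"
    using linear_conv_bounded_linear by blast+
  have tm: "tangent_map (\<lambda>w. \<psi> (P w)) (P -` U)"
    by (rule tangent_map_compose[OF P(1,2) U(1)]) (metis U(2) der subset_refl)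
  have "vec.dim (D (\<psi> w)) = vec.dim S" if w: "w \<in> W" for w
  proof -
    obtain \<phi>' where \<phi>': "Vector_Spaces.linear (*s) (*s) \<phi>'" "inj_on \<phi>' S" "\<phi>' ` S = D (\<psi> w)"
      using der[OF w] by blast
    then show ?thesis
      using vec.dim_image_eq[OF \<phi>'(1), of S] vec.span_eq_iff[THEN iffD2, OF S] by simp
  qed
  then have dims: "\<forall>w\<in>P -` U. vec.dim (D (\<psi> (P w))) = vec.dim (D (\<psi> w0))"
    using w0 P(2) U(2) by (metis IntI rangeI subsetD vimageD)
  obtain B \<rho> K V where slice: "slice_chart (\<psi> w0) B \<rho> K V" using slice_chart_exists by blast
  then have V: "open V" "0 \<in> V" "\<rho> 0 = \<psi> w0"
    and orb: "\<And>z. z \<in> coord_space B \<Longrightarrow> \<rho> z \<in> orbit (\<psi> w0)"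
    by (simp_all only: slice_chart_def)
  have Pw0: "P w0 = w0" using P(3) w0 U(2) by blast
  have "0 \<in> coord_space B" by (rule vec.subspace_0[OF subspace_coord_space])
  then have "\<psi> (P w0) \<in> \<rho> ` (coord_space B \<inter> V)" using V(2,3) Pw0 by (metis IntI image_eqI)
  then obtain \<delta> where \<delta>: "\<delta> > 0" "(\<lambda>w. \<psi> (P w)) ` ball w0 \<delta> \<subseteq> \<rho> ` (coord_space B \<inter> V)"
    using slice_chart_unique[OF slice tm dims _ V(1) order.refl, of w0] Pw0 w0 U(2) by auto
  define N where "N = \<psi> ` (W \<inter> ball w0 \<delta>)"
  have "openin (subtopology T (\<psi> ` W)) N"
    using homeomorphic_imp_open_map[OF homeo] openin_open_Int[OF open_ball]
    unfolding open_map_def N_def by blast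
  then have "openin T N" using oT openin_trans_full by blast
  moreover have "\<psi> w0 \<in> N" using w0 \<delta>(1) by (auto simp: N_def)
  moreover have "N \<subseteq> orbit (\<psi> w0)"
  proof
    fix y assume "y \<in> N"
    then obtain w where w: "w \<in> W" "w \<in> ball w0 \<delta>" "y = \<psi> w" by (auto simp: N_def)
    then have "y = \<psi> (P w)" using P(3) U(2) by simp
    moreover have "\<psi> (P w) \<in> \<rho> ` (coord_space B \<inter> V)"
      using subsetD[OF \<delta>(2) imageI[OF w(2)]] .
    ultimately obtain z where "y = \<rho> z" "z \<in> coord_space B" by (elim imageE) simp
    then show "y \<in> orbit (\<psi> w0)" using orb by simp
  qed
  ultimately show ?thesis by blast
qed

text \<open>Orbits cut an integral manifold into disjoint open pieces.\<close>

lemma integral_manifold_subset_orbit: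
  assumes T: "connected_integral_manifold D M T" and y: "y \<in> topspace T"
  shows "topspace T \<subseteq> orbit y"
proof -
  have conn: "connected_space T" using T by (simp add: connected_integral_manifold_def)
  have nbhd: "\<exists>N. openin T N \<and> z \<in> N \<and> N \<subseteq> orbit z" if "z \<in> topspace T" for z
  proof -
    have "\<exists>S W \<psi>. integral_chart D T S W \<psi> \<and> z \<in> \<psi> ` W"
      using T that unfolding connected_integral_manifold_def by (elim conjE) (rule bspec)
    then obtain S W \<psi> where chart: "integral_chart D T S W \<psi>" and "z \<in> \<psi> ` W" by (elim exE conjE)
    then obtain w where "w \<in> W" "z = \<psi> w" by (elim imageE)
    then show ?thesis using integral_chart_local_orbit[OF chart] by simp
  qed
  let ?E1 = "topspace T \<inter> orbit y" and ?E2 = "topspace T - orbit y"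
  have "openin T ?E1"
  proof (subst openin_subopen, intro ballI)
    fix z assume z: "z \<in> ?E1"
    then obtain N where "openin T N" "z \<in> N" "N \<subseteq> orbit z" using nbhd by blast
    moreover have "orbit z = orbit y" using z by (intro orbit_eq) blast
    ultimately show "\<exists>N. openin T N \<and> z \<in> N \<and> N \<subseteq> ?E1" using openin_subset[of T N] by blast
  qed
  moreover have "openin T ?E2"
  proof (subst openin_subopen, intro ballI)
    fix z assume z: "z \<in> ?E2"
    then obtain N where "openin T N" "z \<in> N" "N \<subseteq> orbit z" using nbhd by blast
    moreover have "orbit z \<inter> orbit y = {}" using z orbit_eq orbit_refl by blast
    ultimately show "\<exists>N. openin T N \<and> z \<in> N \<and> N \<subseteq> ?E2" using openin_subset[of T N] by blast
  qed
  ultimately have "?E2 = {}"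
    using conn y orbit_refl[of y] unfolding connected_space_def by blast
  then show ?thesis by blast
qed

theorem symplectic_leaf_iff_orbit: "symplectic_leaf \<pi> M L \<longleftrightarrow> (\<exists>x\<in>M. L = orbit x)"
proof
  assume L: "symplectic_leaf \<pi> M L"
  then obtain T where T: "connected_integral_manifold D M T" "topspace T = L"
    unfolding symplectic_leaf_def ham_distribution_eq_D by blast
  then obtain x where x: "x \<in> L" "x \<in> M" unfolding connected_integral_manifold_def by blast
  have "L \<subseteq> orbit x" using integral_manifold_subset_orbit T x(1) by blast
  then have "orbit x = L"
    using L orbit_integral_manifold[OF x(2)] topspace_orbit_topology
    unfolding symplectic_leaf_def ham_distribution_eq_D by metis
  then show "\<exists>x\<in>M. L = orbit x" using x(2) by blast
next
  assume "\<exists>x\<in>M. L = orbit x"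
  then obtain x where x: "x \<in> M" "L = orbit x" by blast
  show "symplectic_leaf \<pi> M L"
    unfolding symplectic_leaf_def ham_distribution_eq_D
  proof (intro conjI exI allI impI)
    show "connected_integral_manifold D M (orbit_topology x)" by (rule orbit_integral_manifold[OF x(1)])
    show "topspace (orbit_topology x) = L" by (simp add: topspace_orbit_topology x(2))
    fix T' assume "connected_integral_manifold D M T' \<and> L \<subseteq> topspace T'"
    then show "topspace T' = L"
      using integral_manifold_subset_orbit[of T' x] x(2) orbit_refl by blast
  qed
qed

end

section \<open>Explicit flows of exchange brackets\<close>

text \<open>The entire function \<open>(exp z - 1) / z\<close>. It integrates exponentials uniformly in the
exponent, including the exponent \<open>0\<close>.\<close>

definition exp_quot :: "complex \<Rightarrow> complex" where
  "exp_quot z = (if z = 0 then 1 else (exp z - 1) / z)"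

lemma exp_quot_mult: "z * exp_quot z = exp z - 1"
  by (simp add: exp_quot_def)

lemma exp_quot_0: "exp_quot 0 = 1"
  by (simp add: exp_quot_def)

lemma exp_quot_holomorphic: "exp_quot holomorphic_on UNIV"
proof -
  have "(\<lambda>z. if z = 0 then deriv exp 0 else (exp z - exp 0) / (z - 0)) holomorphic_on (UNIV :: complex set)"
    by (rule pole_lemma_open) (auto intro!: holomorphic_intros)
  moreover have "deriv exp (0 :: complex) = 1"
    by (metis DERIV_exp DERIV_imp_deriv exp_zero)
  then have "(\<lambda>z. if z = 0 then deriv exp 0 else (exp z - exp 0) / (z - 0)) = exp_quot"
    by (auto simp: exp_quot_def)
  ultimately show ?thesis by simp
qed

definition exp_quot' :: "complex \<Rightarrow> complex" where "exp_quot' = deriv exp_quot"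

lemma exp_quot_deriv: "(exp_quot has_field_derivative exp_quot' z) (at z)"
  unfolding exp_quot'_def using exp_quot_holomorphic by (auto intro: holomorphic_derivI)

lemma exp_quot'_holomorphic: "exp_quot' holomorphic_on UNIV"
  unfolding exp_quot'_def using exp_quot_holomorphic by (intro holomorphic_deriv) auto

lemma exp_quot_ode: "exp_quot z + z * exp_quot' z = exp z"
proof -
  have "((\<lambda>z. z * exp_quot z) has_field_derivative exp_quot z + z * exp_quot' z) (at z)"
    by (auto intro!: derivative_eq_intros exp_quot_deriv)
  moreover have "((\<lambda>z. z * exp_quot z) has_field_derivative exp z) (at z)"
    unfolding exp_quot_mult by (auto intro!: derivative_eq_intros)
  ultimately show ?thesis by (rule DERIV_unique)
qed

lemma continuous_exp_quot: "continuous_on S exp_quot" "continuous_on S exp_quot'"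
  using exp_quot_holomorphic exp_quot'_holomorphic
  by (auto intro: continuous_on_subset dest: holomorphic_on_imp_continuous_on)

lemma has_derivative_vec_componentwise:
  fixes f :: "'a::real_normed_vector \<Rightarrow> complex ^ 'c::finite"
  assumes "\<And>c. ((\<lambda>x. f x $ c) has_derivative (\<lambda>v. f' v $ c)) (at x)"
  shows "(f has_derivative f') (at x)"
  unfolding has_derivative_componentwise_within[of f f']
proof
  fix i :: "complex ^ 'c" assume "i \<in> Basis"
  then obtain c u where i: "i = axis c u" by (auto simp: Basis_vec_def)
  have "((\<lambda>x. f x $ c \<bullet> u) has_derivative (\<lambda>v. f' v $ c \<bullet> u)) (at x)"
    by (rule has_derivative_inner_left[OF assms])
  then show "((\<lambda>x. f x \<bullet> i) has_derivative (\<lambda>v. f' v \<bullet> i)) (at x)"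
    by (simp add: i inner_axis)
qed

lemma field_derivative_compose:
  assumes "(f has_field_derivative D) (at (g x))" "(g has_derivative g') (at x)"
  shows "((\<lambda>x. f (g x)) has_derivative (\<lambda>v. D * g' v)) (at x)"
  using has_derivative_compose[OF assms(2), of f "(*) D"] assms(1) by (simp add: has_field_derivative_def)

lemma sum_of_bool_mult: "(\<Sum>d\<in>UNIV. of_bool (c = d) * f d) = (f (c::'c::finite) :: complex)"
proof -
  have "(\<Sum>d\<in>UNIV. of_bool (c = d) * f d) = (\<Sum>d\<in>UNIV. if c = d then f d else 0)"
    by (intro sum.cong) auto
  then show ?thesis by simp
qed

definition exchange_term ::
  "('c \<Rightarrow> 'c \<Rightarrow> complex) \<Rightarrow> ('c \<Rightarrow> 'c \<Rightarrow> 'c) \<Rightarrow> 'c \<Rightarrow> 'c \<Rightarrow> complex ^ 'c::finite \<Rightarrow> complex" where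
  "exchange_term \<theta> m b c x = \<theta> b c * x $ m b c * x $ m c b"

text \<open>The iterated bracket \<open>{{x_b, x_c}, x_d}\<close> for the bracket that consists of the exchange terms alone.\<close>

definition exchange_double ::
  "('c \<Rightarrow> 'c \<Rightarrow> complex) \<Rightarrow> ('c \<Rightarrow> 'c \<Rightarrow> 'c)
    \<Rightarrow> 'c \<Rightarrow> 'c \<Rightarrow> 'c \<Rightarrow> complex ^ 'c::finite \<Rightarrow> complex" where
  "exchange_double \<theta> m b c d x =
     \<theta> b c * (exchange_term \<theta> m (m b c) d x * x $ m c b + x $ m b c * exchange_term \<theta> m (m c b) d x)"

text \<open>The conditions express that \<open>b, c\<close> and \<open>m b c, m c b\<close> are opposite pairs of corners of a rectangle
and that \<open>\<tau>\<close> and \<open>\<theta>\<close> are additive in the sides. They are asked only where the exchange term is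
present, so that coordinates without exchange terms fit in with an arbitrary value of \<open>m\<close>. The last
condition is the Jacobi identity of the exchange terms.\<close>

locale exchange_bracket =
  fixes \<tau> \<theta> :: "'c::finite \<Rightarrow> 'c \<Rightarrow> complex" and m :: "'c \<Rightarrow> 'c \<Rightarrow> 'c"
  assumes \<tau>_skew: "\<tau> b c = - \<tau> c b"
    and \<theta>_skew: "\<theta> b c = - \<theta> c b"
    and \<tau>_exchange: "\<theta> b c \<noteq> 0 \<Longrightarrow> \<tau> d (m b c) + \<tau> d (m c b) = \<tau> d b + \<tau> d c"
    and m_exchange: "\<theta> b c \<noteq> 0 \<Longrightarrow> m b (m b c) = m b c" "\<theta> b c \<noteq> 0 \<Longrightarrow> m (m b c) b = b"
      "\<theta> b c \<noteq> 0 \<Longrightarrow> m b (m c b) = b" "\<theta> b c \<noteq> 0 \<Longrightarrow> m (m c b) b = m c b"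
    and \<theta>_exchange: "\<theta> b c \<noteq> 0 \<Longrightarrow> \<theta> b (m b c) + \<theta> b (m c b) = \<theta> b c"
    and exchange_jacobi: "exchange_double \<theta> m b c d x + exchange_double \<theta> m c d b x
      + exchange_double \<theta> m d b c x = 0"
begin

definition bracket :: "'c coord_brackets" where
  "bracket b c x = \<tau> b c * x $ b * x $ c + exchange_term \<theta> m b c x"

text \<open>Along the flow of \<open>x_b\<close>, with constant value \<open>\<kappa>\<close> of \<open>x_b\<close>, this is the coefficient with which the
exchange product is added to \<open>x_c\<close>, up to the exponential factor of \<open>x_c\<close> itself.\<close>

definition drift :: "'c \<Rightarrow> 'c \<Rightarrow> complex \<Rightarrow> complex \<Rightarrow> complex" where
  "drift b c \<kappa> t = \<theta> b c * t * exp_quot (\<theta> b c * \<kappa> * t)"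

definition flow :: "'c \<Rightarrow> complex \<Rightarrow> complex ^ 'c \<Rightarrow> complex ^ 'c" where
  "flow b t x = (\<chi> c. exp (\<tau> b c * x $ b * t) * (x $ c + drift b c (x $ b) t * (x $ m b c * x $ m c b)))"

definition flow_Jacobian :: "'c \<Rightarrow> complex \<Rightarrow> complex ^ 'c \<Rightarrow> complex ^ 'c ^ 'c" where
  "flow_Jacobian b t x = (\<chi> c d.
     of_bool (c = d) * exp (\<tau> b c * x $ b * t)
     + of_bool (m b c = d) * (exp (\<tau> b c * x $ b * t) * drift b c (x $ b) t * x $ m c b)
     + of_bool (m c b = d) * (exp (\<tau> b c * x $ b * t) * drift b c (x $ b) t * x $ m b c)
     + of_bool (b = d) * (\<tau> b c * t * flow b t x $ c + exp (\<tau> b c * x $ b * t) *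
         ((\<theta> b c * t)\<^sup>2 * exp_quot' (\<theta> b c * x $ b * t)) * (x $ m b c * x $ m c b)))"

lemma bracket_skew: "bracket b c x = - bracket c b x"
  using \<tau>_skew[of b c] \<theta>_skew[of b c] by (simp add: bracket_def exchange_term_def)

lemma \<tau>_self: "\<tau> b b = 0" and \<theta>_self: "\<theta> b b = 0"
  using \<tau>_skew[of b b] \<theta>_skew[of b b] by simp_all

lemma drift_0: "drift b c \<kappa> 0 = 0"
  by (simp add: drift_def)

lemma drift_zero: "\<theta> b c = 0 \<Longrightarrow> drift b c \<kappa> t = 0"
  by (simp add: drift_def)

lemma mult_drift: "\<kappa> * drift b c \<kappa> t = exp (\<theta> b c * \<kappa> * t) - 1"
  using exp_quot_mult[of "\<theta> b c * \<kappa> * t"] by (simp add: drift_def algebra_simps)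

lemma drift_add: "drift b c \<kappa> (s + t) = drift b c \<kappa> t + exp (\<theta> b c * \<kappa> * t) * drift b c \<kappa> s"
proof (cases "\<kappa> = 0")
  case True
  then show ?thesis by (simp add: drift_def exp_quot_0 algebra_simps)
next
  case False
  have "\<kappa> * drift b c \<kappa> (s + t) = \<kappa> * (drift b c \<kappa> t + exp (\<theta> b c * \<kappa> * t) * drift b c \<kappa> s)"
    unfolding distrib_left mult.left_commute[of \<kappa> "exp _"] mult_drift
    by (simp add: algebra_simps exp_add)
  then show ?thesis using False by simp
qed

lemma flow_fixes: "flow b t x $ b = x $ b"
  by (simp add: flow_def \<tau>_self drift_zero \<theta>_self)

text \<open>For the two exchanged entries the rectangle with corner \<open>b\<close> degenerates, so the exchange product is
\<open>\<kappa>\<close> times the entry itself and the drift turns into an exponential by \<open>mult_drift\<close>.\<close>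

lemma flow_factor:
  assumes "\<theta> b c \<noteq> 0"
  shows "flow b t x $ m b c = exp ((\<tau> b (m b c) + \<theta> b (m b c)) * x $ b * t) * x $ m b c"
    and "flow b t x $ m c b = exp ((\<tau> b (m c b) + \<theta> b (m c b)) * x $ b * t) * x $ m c b"
proof -
  have *: "flow b t x $ e = exp ((\<tau> b e + \<theta> b e) * x $ b * t) * x $ e"
    if "x $ m b e * x $ m e b = x $ b * x $ e" for e
  proof -
    have "x $ e + drift b e (x $ b) t * (x $ m b e * x $ m e b) = x $ e + (x $ b * drift b e (x $ b) t) * x $ e"
      unfolding that by (simp add: algebra_simps)
    also have "\<dots> = exp (\<theta> b e * x $ b * t) * x $ e"
      unfolding mult_drift by (simp add: algebra_simps)
    finally show ?thesis by (simp add: flow_def exp_add distrib_right)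
  qed
  show "flow b t x $ m b c = exp ((\<tau> b (m b c) + \<theta> b (m b c)) * x $ b * t) * x $ m b c"
    "flow b t x $ m c b = exp ((\<tau> b (m c b) + \<theta> b (m c b)) * x $ b * t) * x $ m c b"
    using m_exchange[OF assms] by (intro *; simp)+
qed

lemma flow_product:
  assumes "\<theta> b c \<noteq> 0"
  shows "flow b t x $ m b c * flow b t x $ m c b
    = exp ((\<tau> b c + \<theta> b c) * x $ b * t) * (x $ m b c * x $ m c b)"
proof -
  have eq: "\<tau> b c + \<theta> b c = (\<tau> b (m b c) + \<theta> b (m b c)) + (\<tau> b (m c b) + \<theta> b (m c b))"
    using \<tau>_exchange[OF assms, of b] \<theta>_exchange[OF assms] by (simp add: \<tau>_self algebra_simps)
  show ?thesis
    unfolding flow_factor[OF assms] eq by (simp add: distrib_right exp_add)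
qed

lemma flow_zero: "flow b 0 x = x"
  by (simp add: flow_def vec_eq_iff drift_0)

text \<open>The exchange product is multiplied by an exponential, which is what \<open>drift_add\<close> asks for.\<close>

lemma flow_add: "flow b (s + t) x = flow b s (flow b t x)"
proof -
  have "flow b (s + t) x $ c = flow b s (flow b t x) $ c" for c
  proof (cases "\<theta> b c = 0")
    case True
    then have z: "flow b s y $ c = exp (\<tau> b c * y $ b * s) * y $ c" for s y
      by (simp add: flow_def drift_zero)
    show ?thesis
      unfolding z flow_fixes by (simp add: exp_add distrib_left mult.assoc)
  next
    case False
    let ?k = "x $ b" and ?p = "x $ m b c * x $ m c b"
    have "flow b s (flow b t x) $ c = exp (\<tau> b c * ?k * s) * (flow b t x $ c
       + drift b c ?k s * (exp ((\<tau> b c + \<theta> b c) * ?k * t) * ?p))"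
      unfolding flow_def[of b s] by (simp add: flow_fixes flow_product[OF False])
    also have "\<dots> = exp (\<tau> b c * ?k * (s + t)) * (x $ c + (drift b c ?k t + exp (\<theta> b c * ?k * t) * drift b c ?k s) * ?p)"
      by (simp add: flow_def exp_add distrib_left distrib_right)
    finally show ?thesis unfolding drift_add[symmetric] by (simp add: flow_def)
  qed
  then show ?thesis by (simp add: vec_eq_iff)
qed

lemma flow_minus: "flow b (- t) (flow b t x) = x"
  by (simp add: flow_zero flip: flow_add)

lemma bracket_flow: "bracket b c (flow b t x)
    = \<tau> b c * x $ b * flow b t x $ c + \<theta> b c * exp ((\<tau> b c + \<theta> b c) * x $ b * t) * (x $ m b c * x $ m c b)"
  using flow_product[of b c t x] by (cases "\<theta> b c = 0") (simp_all add: bracket_def exchange_term_def flow_fixes mult.assoc)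

lemma flow_Jacobian_mult:
  "(flow_Jacobian b t x *v v) $ c = exp (\<tau> b c * x $ b * t) *
      (v $ c + drift b c (x $ b) t * (x $ m c b * v $ m b c + x $ m b c * v $ m c b))
    + (\<tau> b c * t * flow b t x $ c +
        exp (\<tau> b c * x $ b * t) * ((\<theta> b c * t)\<^sup>2 * exp_quot' (\<theta> b c * x $ b * t)) * (x $ m b c * x $ m c b)) * v $ b"
  unfolding flow_Jacobian_def matrix_vector_mult_def
  by (simp add: distrib_right sum.distrib mult.assoc sum_of_bool_mult )
    (simp add: algebra_simps)

lemma flow_has_derivative:
  "((\<lambda>p. flow b (fst p) (snd p)) has_derivative
     (\<lambda>q. fst q *s row b (bracket_matrix bracket (flow b t x)) + flow_Jacobian b t x *v snd q)) (at (t, x))"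
proof (rule has_derivative_vec_componentwise)
  fix c
  have f: "(fst has_derivative fst) (at (t, x))"
    by (rule bounded_linear_imp_has_derivative[OF bounded_linear_fst])
  have s: "((\<lambda>p. snd p $ e) has_derivative (\<lambda>q. snd q $ e)) (at (t, x))" for e :: 'c
    by (rule bounded_linear_imp_has_derivative[OF bounded_linear_compose[OF bounded_linear_vec_nth bounded_linear_snd]])
  have arg: "((\<lambda>p. z * snd p $ b * fst p) has_derivative (\<lambda>q. z * (snd q $ b * t + x $ b * fst q))) (at (t, x))" for z
    by (rule has_derivative_eq_rhs[OF has_derivative_mult[OF has_derivative_mult[OF has_derivative_const s] f]])
      (simp add: fun_eq_iff algebra_simps)
  note e1 = field_derivative_compose[OF DERIV_exp arg[of "\<tau> b c"]]
  note e2 = field_derivative_compose[OF exp_quot_deriv arg[of "\<theta> b c"]]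
  have ode: "exp_quot (\<theta> b c * x $ b * t) + \<theta> b c * x $ b * t * exp_quot' (\<theta> b c * x $ b * t) = exp (\<theta> b c * x $ b * t)"
    by (rule exp_quot_ode)
  have fl: "(\<lambda>p. flow b (fst p) (snd p) $ c) = (\<lambda>p. exp (\<tau> b c * snd p $ b * fst p) *
      (snd p $ c + \<theta> b c * fst p * exp_quot (\<theta> b c * snd p $ b * fst p) * (snd p $ m b c * snd p $ m c b)))"
    by (simp add: flow_def drift_def)
  show "((\<lambda>p. flow b (fst p) (snd p) $ c) has_derivative
      (\<lambda>q. (fst q *s row b (bracket_matrix bracket (flow b t x)) + flow_Jacobian b t x *v snd q) $ c)) (at (t, x))"
    unfolding fl
  proof (rule has_derivative_eq_rhs[OF has_derivative_mult[OF e1 has_derivative_add[OF s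
            has_derivative_mult[OF has_derivative_mult[OF has_derivative_mult[OF has_derivative_const f] e2]
              has_derivative_mult[OF s s]]]]], rule ext)
  qed (simp only: vector_add_component vector_smult_component flow_Jacobian_mult row_def
      bracket_matrix_def vec_lambda_beta bracket_flow distrib_right exp_add ode[symmetric] fst_conv snd_conv,
      simp add: flow_def drift_def algebra_simps power2_eq_square)
qed

lemma flow_has_derivative_space: "(flow b t has_derivative (*v) (flow_Jacobian b t x)) (at x)"
proof -
  have "((\<lambda>y. (t, y)) has_derivative (\<lambda>v. (0, v))) (at x)"
    by (auto intro!: derivative_eq_intros)
  from has_derivative_compose[OF this flow_has_derivative]
  show ?thesis by simp
qed

lemma flow_component_deriv_0: "((\<lambda>s. flow b s y $ c) has_field_derivative bracket b c y) (at 0)"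
proof -
  have "((\<lambda>t. (t, y)) has_derivative (\<lambda>v. (v, 0))) (at 0)"
    by (auto intro!: derivative_eq_intros)
  from bounded_linear.has_derivative[OF bounded_linear_vec_nth[of c] has_derivative_compose[OF this flow_has_derivative]]
  have "((\<lambda>s. flow b s y $ c) has_derivative (\<lambda>v. v * bracket b c y)) (at 0)"
    by (simp add: flow_zero row_def bracket_matrix_def)
  moreover have "(*) (bracket b c y) = (\<lambda>v. v * bracket b c y)" by (simp add: fun_eq_iff)
  ultimately show ?thesis by (simp only: has_field_derivative_def)
qed

lemma continuous_flow_Jacobian: "continuous_on UNIV (\<lambda>p. flow_Jacobian b (fst p) (snd p))"
  unfolding flow_Jacobian_def flow_def drift_def vec_lambda_beta
  by (intro continuous_intros continuous_on_compose2[OF continuous_exp_quot(1)[of UNIV]]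
        continuous_on_compose2[OF continuous_exp_quot(2)[of UNIV]]) auto

lemma flow_Jacobian_zero: "flow_Jacobian b 0 x = mat 1"
  by (simp add: flow_Jacobian_def drift_0 vec_eq_iff mat_def of_bool_def)

lemma flow_Jacobian_add:
  "flow_Jacobian b (s + t) x = flow_Jacobian b s (flow b t x) ** flow_Jacobian b t x"
proof -
  have "((\<lambda>x. flow b s (flow b t x)) has_derivative
      (\<lambda>v. flow_Jacobian b s (flow b t x) *v (flow_Jacobian b t x *v v))) (at x)"
    by (rule has_derivative_compose[OF flow_has_derivative_space flow_has_derivative_space])
  then have "(flow b (s + t) has_derivative
      (\<lambda>v. flow_Jacobian b s (flow b t x) *v (flow_Jacobian b t x *v v))) (at x)"
    by (simp only: flow_add[symmetric])
  from has_derivative_unique[OF flow_has_derivative_space this]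
  show ?thesis unfolding matrix_eq by (simp add: fun_eq_iff matrix_vector_mul_assoc)
qed

end

section \<open>Invariance of exchange brackets under their flows\<close>

definition matrix_deriv :: "(complex \<Rightarrow> complex ^ 'n::finite ^ 'm::finite) \<Rightarrow> complex ^ 'n ^ 'm \<Rightarrow> complex \<Rightarrow> bool" where
  "matrix_deriv A A' s \<longleftrightarrow> (\<forall>i j. ((\<lambda>s. A s $ i $ j) has_field_derivative A' $ i $ j) (at s))"

lemma matrix_deriv_mult:
  assumes "matrix_deriv A A' s" "matrix_deriv B B' s"
  shows "matrix_deriv (\<lambda>s. A s ** B s) (A' ** B s + A s ** B') s"
proof -
  have "((\<lambda>s. \<Sum>k\<in>UNIV. A s $ i $ k * B s $ k $ j) has_field_derivative
      (\<Sum>k\<in>UNIV. A' $ i $ k * B s $ k $ j + A s $ i $ k * B' $ k $ j)) (at s)" for i j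
  proof (rule DERIV_sum)
    fix k
    have "((\<lambda>s. A s $ i $ k) has_field_derivative A' $ i $ k) (at s)"
      "((\<lambda>s. B s $ k $ j) has_field_derivative B' $ k $ j) (at s)"
      using assms by (simp_all add: matrix_deriv_def)
    then show "((\<lambda>s. A s $ i $ k * B s $ k $ j) has_field_derivative
        A' $ i $ k * B s $ k $ j + A s $ i $ k * B' $ k $ j) (at s)"
      by (rule DERIV_cong[OF DERIV_mult]) simp
  qed
  then show ?thesis
    by (simp add: matrix_deriv_def matrix_matrix_mult_def sum.distrib)
qed

lemma matrix_deriv_transpose: "matrix_deriv A A' s \<Longrightarrow> matrix_deriv (\<lambda>s. transpose (A s)) (transpose A') s"
  by (simp add: matrix_deriv_def transpose_def)

lemma matrix_deriv_const: "matrix_deriv (\<lambda>s. A) 0 s"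
  by (simp add: matrix_deriv_def)

lemma matrix_deriv_zero_constant:
  assumes "\<And>s. matrix_deriv A 0 s"
  shows "A s = A t"
proof -
  have "A s $ i $ j = A t $ i $ j" for i j
  proof -
    have "\<exists>c. \<forall>s\<in>UNIV. A s $ i $ j = c"
      using assms unfolding matrix_deriv_def
      by (intro has_field_derivative_zero_constant) auto
    then show ?thesis by auto
  qed
  then show ?thesis by (simp add: vec_eq_iff)
qed

lemma DERIV_mult_self_0: "isCont g 0 \<Longrightarrow> ((\<lambda>s. s * g s) has_field_derivative g 0) (at (0 :: complex))"
  unfolding CARAT_DERIV by (intro exI[of _ g]) simp

lemma isCont_exp_quot_compose:
  "isCont f s \<Longrightarrow> isCont (\<lambda>s. exp_quot (f s)) s" "isCont f s \<Longrightarrow> isCont (\<lambda>s. exp_quot' (f s)) s"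
proof -
  have "isCont exp_quot z" "isCont exp_quot' z" for z
    using continuous_exp_quot[of UNIV] by (simp_all add: continuous_on_eq_continuous_at)
  note this[THEN isCont_o2[rotated]]
  then show "isCont f s \<Longrightarrow> isCont (\<lambda>s. exp_quot (f s)) s" "isCont f s \<Longrightarrow> isCont (\<lambda>s. exp_quot' (f s)) s"
    by auto
qed

context exchange_bracket
begin

text \<open>The Jacobian matrix of the Hamiltonian vector field of \<open>x_b\<close>.\<close>

definition linearization :: "'c \<Rightarrow> complex ^ 'c \<Rightarrow> complex ^ 'c ^ 'c" where
  "linearization b y = (\<chi> c d. of_bool (c = d) * (\<tau> b c * y $ b)
     + of_bool (m b c = d) * (\<theta> b c * y $ m c b)
     + of_bool (m c b = d) * (\<theta> b c * y $ m b c)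
     + of_bool (b = d) * (\<tau> b c * y $ c))"

text \<open>The iterated bracket \<open>{{x_b, x_c}, x_d}\<close>.\<close>

definition double_bracket :: "'c \<Rightarrow> 'c \<Rightarrow> 'c \<Rightarrow> complex ^ 'c \<Rightarrow> complex" where
  "double_bracket b c d x = \<tau> b c * (x $ c * bracket b d x + x $ b * bracket c d x)
     + \<theta> b c * (x $ m c b * bracket (m b c) d x + x $ m b c * bracket (m c b) d x)"

lemma linearization_bracket: "(linearization b y ** bracket_matrix bracket y) $ c $ d = double_bracket b c d y"
  unfolding linearization_def matrix_matrix_mult_def bracket_matrix_def double_bracket_def
  by (simp add: distrib_right sum.distrib mult.assoc sum_of_bool_mult) (simp add: algebra_simps)

lemma double_bracket_swap: "double_bracket b c d x = - double_bracket c b d x"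
  unfolding double_bracket_def \<tau>_skew[of b c] \<theta>_skew[of b c] by (simp add: algebra_simps)

text \<open>Additivity of \<open>\<tau>\<close> makes the mixed terms depend on \<open>x_b, x_c\<close> only through the exchange term, as if it
were the product \<open>x_b x_c\<close>.\<close>

lemma double_bracket_expand:
  "double_bracket b c d x = x $ b * x $ c * x $ d * (\<tau> b c * (\<tau> b d + \<tau> c d))
     + \<tau> b c * (x $ c * exchange_term \<theta> m b d x + x $ b * exchange_term \<theta> m c d x)
     + (\<tau> b d + \<tau> c d) * exchange_term \<theta> m b c x * x $ d
     + exchange_double \<theta> m b c d x"
proof -
  have "\<theta> b c * (\<tau> (m b c) d + \<tau> (m c b) d) = \<theta> b c * (\<tau> b d + \<tau> c d)"
    using \<tau>_exchange[of b c d] \<tau>_skew[of d b] \<tau>_skew[of d c] \<tau>_skew[of d "m b c"] \<tau>_skew[of d "m c b"]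
    by (cases "\<theta> b c = 0") (auto simp: algebra_simps neg_eq_iff_add_eq_0 add_eq_0_iff)
  then have "\<theta> b c * (\<tau> (m b c) d + \<tau> (m c b) d) * (x $ m b c * x $ m c b * x $ d)
      = \<theta> b c * (\<tau> b d + \<tau> c d) * (x $ m b c * x $ m c b * x $ d)" by simp
  then show ?thesis
    unfolding double_bracket_def bracket_def exchange_double_def by (simp add: exchange_term_def algebra_simps)
qed

text \<open>The log-canonical part satisfies the Jacobi identity by skewness of \<open>\<tau>\<close>, and the mixed terms
cancel in the cyclic sum; what remains is the identity for the exchange terms.\<close>

lemma jacobi: "double_bracket b c d x + double_bracket c d b x + double_bracket d b c x = 0"
proof -
  have skew: "exchange_term \<theta> m c b x = - exchange_term \<theta> m b c x" for b c
    using \<theta>_skew[of b c] by (simp add: exchange_term_def)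
  show ?thesis
    unfolding double_bracket_expand
    using exchange_jacobi[of b c d x]
    unfolding skew[of b d] skew[of b c] skew[of c d] \<tau>_skew[of d b] \<tau>_skew[of c b] \<tau>_skew[of d c]
    by (simp add: algebra_simps)
qed

text \<open>At time \<open>s\<close> this is the inverse of the Jacobian of \<open>flow b s\<close>, hence the sign. Every term
except the exponential carries a factor \<open>s\<close>, so continuity of the other factors gives the derivative.\<close>

lemma Jacobian_linearization:
  "matrix_deriv (\<lambda>s. flow_Jacobian b (- s) (flow b s y)) (- linearization b y) 0"
  unfolding matrix_deriv_def
proof (intro allI)
  fix c d
  define k where "k = y $ b"
  let ?e = "\<lambda>s. exp (\<tau> b c * k * - s)" and ?q = "\<lambda>s. \<theta> b c * k * - s" and ?F = "\<lambda>e s. flow b s y $ e"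
  let ?G = "\<lambda>e s. - (?e s * \<theta> b c * exp_quot (?q s) * ?F e s)"
  let ?H = "\<lambda>s. - \<tau> b c * y $ c + s * (?e s * ((\<theta> b c)\<^sup>2 * exp_quot' (?q s)) * (?F (m b c) s * ?F (m c b) s))"
  have eq: "flow_Jacobian b (- s) (flow b s y) $ c $ d =
     of_bool (c = d) * ?e s + of_bool (m b c = d) * (s * ?G (m c b) s)
     + of_bool (m c b = d) * (s * ?G (m b c) s) + of_bool (b = d) * (s * ?H s)" for s
    by (simp add: flow_Jacobian_def flow_fixes flow_minus drift_def k_def algebra_simps power2_eq_square)
  have F: "isCont (?F e) 0" for e by (rule DERIV_isCont[OF flow_component_deriv_0])
  have "isCont (?G e) 0" for e
    by (intro continuous_intros isCont_exp_quot_compose F)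
  note dG = DERIV_mult_self_0[OF this]
  have "isCont ?H 0"
    by (intro continuous_intros isCont_exp_quot_compose F)
  note dH = DERIV_mult_self_0[OF this]
  have de: "(?e has_field_derivative - (\<tau> b c * k)) (at 0)"
    by (auto intro!: derivative_eq_intros)
  show "((\<lambda>s. flow_Jacobian b (- s) (flow b s y) $ c $ d) has_field_derivative
      (- linearization b y) $ c $ d) (at 0)"
    unfolding eq
    by (rule DERIV_cong[OF DERIV_add[OF DERIV_add[OF DERIV_add[OF
            DERIV_cmult[OF de] DERIV_cmult[OF dG]] DERIV_cmult[OF dG]] DERIV_cmult[OF dH]]])
      (simp add: linearization_def k_def flow_zero exp_quot_0)
qed

lemma bracket_along_flow:
  "matrix_deriv (\<lambda>s. bracket_matrix bracket (flow b s y)) (\<chi> c d. - double_bracket c d b y) 0"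
proof -
  note [derivative_intros] = flow_component_deriv_0
  have "((\<lambda>s. bracket c d (flow b s y)) has_field_derivative - double_bracket c d b y) (at 0)" for c d
    unfolding bracket_def[of c d] exchange_term_def
    by (rule derivative_eq_intros refl)+
      (simp add: double_bracket_def flow_zero bracket_skew[of c b] bracket_skew[of d b] bracket_skew[of "m c d" b]
          bracket_skew[of "m d c" b] algebra_simps)
  then show ?thesis by (simp add: matrix_deriv_def bracket_matrix_def)
qed

text \<open>The bracket at time \<open>t\<close> of the flow of \<open>x_b\<close>, pulled back to time \<open>0\<close>.\<close>

definition pulled_bracket :: "'c \<Rightarrow> complex ^ 'c \<Rightarrow> complex \<Rightarrow> complex ^ 'c ^ 'c" where
  "pulled_bracket b x t = flow_Jacobian b (- t) (flow b t x) ** bracket_matrix bracket (flow b t x)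
     ** transpose (flow_Jacobian b (- t) (flow b t x))"

lemma transpose_bracket: "transpose (bracket_matrix bracket x) = - bracket_matrix bracket x"
  by (simp add: transpose_def bracket_matrix_def vec_eq_iff bracket_skew[of _ _ x, symmetric])

text \<open>The three contributions of the product rule are the three terms of the Jacobi identity.\<close>

lemma pulled_bracket_deriv_0: "matrix_deriv (pulled_bracket b y) 0 0"
proof -
  let ?L = "linearization b y" and ?P = "bracket_matrix bracket y"
  let ?Q = "(\<chi> c d. - double_bracket c d b y) :: complex ^ 'c ^ 'c"
  have "matrix_deriv (pulled_bracket b y)
     ((- ?L ** ?P + mat 1 ** ?Q) ** transpose (mat 1) + (mat 1 ** ?P) ** transpose (- ?L)) 0"
    using matrix_deriv_mult[OF matrix_deriv_mult[OF Jacobian_linearization[of b y] bracket_along_flow[of b y]]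
        matrix_deriv_transpose[OF Jacobian_linearization[of b y]]]
    unfolding pulled_bracket_def[abs_def] by (simp add: flow_zero flow_Jacobian_zero)
  moreover have "(- ?L ** ?P + mat 1 ** ?Q) ** transpose (mat 1) + (mat 1 ** ?P) ** transpose (- ?L) = 0"
  proof -
    have neg: "(- A) ** B = - (A ** B)" "A ** (- B) = - (A ** B)" for A B :: "complex ^ 'c ^ 'c"
      by (simp_all add: matrix_matrix_mult_def vec_eq_iff sum_negf)
    have tneg: "transpose (- ?L) = - transpose ?L" by (simp add: transpose_def vec_eq_iff)
    have "(?P ** transpose ?L) $ c $ d = - (?L ** ?P) $ d $ c" for c d
    proof -
      have "?P ** transpose ?L = transpose (?L ** transpose ?P)" by (simp add: matrix_transpose_mul)
      also have "\<dots> = - transpose (?L ** ?P)"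
        unfolding transpose_bracket neg by (simp add: transpose_def vec_eq_iff)
      finally show ?thesis by (simp add: transpose_def)
    qed
    moreover have "- double_bracket c d b y - double_bracket b c d y + double_bracket b d c y = 0" for c d
      using jacobi[of b c d y] double_bracket_swap[of d b c y] by (simp add: algebra_simps)
    ultimately show ?thesis
      by (simp add: vec_eq_iff neg tneg linearization_bracket transpose_mat)
  qed
  ultimately show ?thesis by simp
qed

lemma pulled_bracket_add:
  "pulled_bracket b x (t + s) = flow_Jacobian b (- t) (flow b t x) ** pulled_bracket b (flow b t x) s
     ** transpose (flow_Jacobian b (- t) (flow b t x))"
proof -
  let ?y = "flow b t x"
  have "flow_Jacobian b (- (t + s)) (flow b (t + s) x)
      = flow_Jacobian b (- t) ?y ** flow_Jacobian b (- s) (flow b s ?y)"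
    using flow_Jacobian_add[of b "- t" "- s" "flow b s ?y"]
    unfolding flow_minus unfolding flow_add[of b s t, symmetric] by (simp add: add.commute)
  then show ?thesis
    unfolding pulled_bracket_def
    by (simp add: matrix_transpose_mul matrix_mul_assoc flow_add[of b s t, symmetric] add.commute)
qed

text \<open>By the group law of the flow, the derivative at time \<open>t\<close> is a linear image of the derivative at
time \<open>0\<close> of the bracket pulled back to the point \<open>flow b t x\<close>.\<close>

lemma pulled_bracket_constant: "pulled_bracket b x t = bracket_matrix bracket x"
proof -
  have "matrix_deriv (pulled_bracket b x) 0 t" for t
  proof -
    let ?C = "flow_Jacobian b (- t) (flow b t x)"
    have "matrix_deriv (\<lambda>s. ?C ** pulled_bracket b (flow b t x) s ** transpose ?C)
       ((0 ** pulled_bracket b (flow b t x) 0 + ?C ** 0) ** transpose ?C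
         + ?C ** pulled_bracket b (flow b t x) 0 ** 0) 0"
      by (intro matrix_deriv_mult matrix_deriv_const pulled_bracket_deriv_0)
    then have "matrix_deriv (\<lambda>s. pulled_bracket b x (t + s)) 0 0"
      unfolding pulled_bracket_add by simp
    then show ?thesis
      unfolding matrix_deriv_def using DERIV_at_within_shift[of "\<lambda>s. pulled_bracket b x s $ _ $ _" _ t 0 UNIV]
      by (simp add: add.commute)
  qed
  then have "pulled_bracket b x t = pulled_bracket b x 0" by (rule matrix_deriv_zero_constant)
  then show ?thesis by (simp add: pulled_bracket_def flow_zero flow_Jacobian_zero transpose_mat)
qed

lemma flow_poisson:
  "flow_Jacobian b t x ** bracket_matrix bracket x ** transpose (flow_Jacobian b t x) = bracket_matrix bracket (flow b t x)"
proof -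
  have "flow b (- t) (flow b t x) = x" by (rule flow_minus)
  then show ?thesis
    using pulled_bracket_constant[of b "flow b t x" "- t"] by (simp add: pulled_bracket_def)
qed

lemma poisson_flows:
  assumes "\<And>b t x. x \<in> M \<Longrightarrow> flow b t x \<in> M"
  shows "poisson_flows bracket M flow flow_Jacobian"
proof
  show "bracket b c x = - bracket c b x" for b c x by (rule bracket_skew)
  show "continuous_on UNIV (bracket b c)" for b c
    unfolding bracket_def[abs_def] exchange_term_def by (intro continuous_intros)
  show "flow b t x \<in> M" if "x \<in> M" for b t x by (rule assms[OF that])
qed (rule flow_zero flow_minus flow_has_derivative continuous_flow_Jacobian flow_poisson)+

end

section \<open>The brackets on matrices and on the product space\<close>

definition ord_sign :: "'n::linorder \<Rightarrow> 'n \<Rightarrow> complex" where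
  "ord_sign i s = (if i < s then 1 else if s < i then -1 else 0)"

lemma ord_sign_less: "i < s \<Longrightarrow> ord_sign i s = 1" and ord_sign_greater: "s < i \<Longrightarrow> ord_sign i s = - 1"
  and ord_sign_self: "ord_sign i i = 0"
  by (simp_all add: ord_sign_def less_not_sym)

lemma ord_sign_skew: "ord_sign i s = - ord_sign s i"
  by (cases i s rule: linorder_cases) (simp_all add: ord_sign_less ord_sign_greater ord_sign_self)

lemma ord_sign_square: "ord_sign i s * ord_sign i s = (if i = s then 0 else 1)"
  by (cases i s rule: linorder_cases) (simp_all add: ord_sign_less ord_sign_greater ord_sign_self)

text \<open>For pairwise distinct elements this is the statement that exactly one of three is in the
middle.\<close>

lemma ord_sign_cocycle:
  "ord_sign i s * ord_sign i u - ord_sign i s * ord_sign s u + ord_sign s u * ord_sign i u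
     = (if i = s \<and> s = u then 0 else 1)"
proof -
  consider "i = s" | "s = u" | "i = u" | "i < s" "s < u" "i < u"| "i < u" "u < s" "i < s"
    | "s < i" "i < u" "s < u" | "s < u" "u < i" "s < i" | "u < i" "i < s" "u < s" | "u < s" "s < i" "u < i"
    using linorder_less_linear[of i s] linorder_less_linear[of s u] linorder_less_linear[of i u]
      less_trans[of i s u] less_trans[of u s i] by blast
  then show ?thesis
  proof cases
    case 3
    define r where "r = ord_sign s u"
    have r: "r * r = (if s = u then 0 else 1)" unfolding r_def by (rule ord_sign_square)
    have "ord_sign u s = - r" unfolding r_def by (rule ord_sign_skew)
    then have "ord_sign u s * ord_sign u u - ord_sign u s * ord_sign s u + ord_sign s u * ord_sign u u = r * r"
      by (simp only: ord_sign_self r_def[symmetric]) simp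
    then show ?thesis
      unfolding \<open>i = u\<close> r by (simp only: eq_commute[of u s] simp_thms)
  qed (auto simp: ord_sign_less ord_sign_greater ord_sign_self ord_sign_square)
qed
fun corner :: "'n \<times> 'n \<Rightarrow> 'n \<times> 'n \<Rightarrow> 'n \<times> 'n" where
  "corner (i, j) (s, t) = (i, t)"

fun std_sign :: "'n::linorder \<times> 'n \<Rightarrow> 'n \<times> 'n \<Rightarrow> complex" where
  "std_sign (i, j) (s, t) = ord_sign i s + ord_sign j t"

fun twist ::
  "('n::{finite,linorder} \<Rightarrow> 'n lattice_P) \<Rightarrow> ('n \<Rightarrow> 'n lattice_P)
    \<Rightarrow> 'n \<times> 'n \<Rightarrow> 'n \<times> 'n \<Rightarrow> complex" where
  "twist \<zeta> \<xi> (i, j) (s, t) = of_int (pairing (\<zeta> i + \<xi> j) (s, t) - pairing (\<zeta> s + \<xi> t) (i, j))"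

text \<open>The standard bracket is \<open>(sign (s - i) + sign (t - j)) a_{it} a_{sj}\<close>: the two signs cancel for a pair
of entries in antidiagonal position and add up to \<open>\<plusminus>2\<close> in diagonal position.\<close>

lemma std_bracket_eq: "std_bracket p q a = exchange_term std_sign corner p q a"
proof -
  obtain i j s t where [simp]: "p = (i, j)" "q = (s, t)" by (metis surj_pair)
  show ?thesis
    by (cases i s rule: linorder_cases; cases j t rule: linorder_cases)
      (auto simp: std_bracket_def exchange_term_def ord_sign_def)
qed

lemma basis_pair_corner: "basis_pair k (corner p q) + basis_pair k (corner q p) = basis_pair k p + basis_pair k q"
proof -
  obtain i j s t where "p = (i, j)" "q = (s, t)" by (metis surj_pair)
  then show ?thesis
    unfolding basis_pair_def by (cases "Rep_weight k") simp_all
qed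

text \<open>Every weight pairs with \<open>\<alpha>_{ij}\<close> to a function of \<open>i\<close> plus a function of \<open>j\<close>.\<close>

lemma pairing_corner: "pairing w (corner p q) + pairing w (corner q p) = pairing w p + pairing w q"
  unfolding pairing_def by (simp only: basis_pair_corner flip: sum.distrib distrib_left)

lemma pairing_add: "pairing (v + w) p = pairing v p + pairing w p"
  unfolding pairing_def by (simp add: distrib_right sum.distrib)

lemma twist_corner: "twist \<zeta> \<xi> d (corner b c) + twist \<zeta> \<xi> d (corner c b) = twist \<zeta> \<xi> d b + twist \<zeta> \<xi> d c"
proof -
  obtain i j s t u v where [simp]: "b = (i, j)" "c = (s, t)" "d = (u, v)" by (metis surj_pair)
  show ?thesis
    using pairing_corner[of "\<zeta> u" b c, THEN arg_cong[of _ _ complex_of_int]]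
      pairing_corner[of "\<xi> v" b c, THEN arg_cong[of _ _ complex_of_int]]
    by (simp add: pairing_add algebra_simps)
qed

text \<open>The iterated brackets involve only the two monomials \<open>X\<close>, \<open>Y\<close> that arise from permuting the
columns cyclically. Their coefficients are opposite, and each is the difference of a row cocycle and a column
cocycle. The cocycles are both \<open>1\<close> unless the three rows, or the three columns, coincide; in that case
\<open>X = Y\<close>.\<close>

lemma std_jacobi:
  "exchange_double std_sign corner b c d x + exchange_double std_sign corner c d b x
     + exchange_double std_sign corner d b c x = 0"
proof -
  obtain i j s t u v where [simp]: "b = (i, j)" "c = (s, t)" "d = (u, v)" by (metis surj_pair)
  define X where "X = x $ (i, v) * x $ (u, t) * x $ (s, j)"
  define Y where "Y = x $ (i, t) * x $ (s, v) * x $ (u, j)"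
  define R C where "R = (if i = s \<and> s = u then 0 else (1::complex))"
    and "C = (if j = t \<and> t = v then 0 else (1::complex))"
  have R: "R = ord_sign i s * ord_sign i u - ord_sign i s * ord_sign s u + ord_sign s u * ord_sign i u"
    unfolding R_def by (rule ord_sign_cocycle[symmetric])
  have C: "C = ord_sign j t * ord_sign j v - ord_sign j t * ord_sign t v + ord_sign t v * ord_sign j v"
    unfolding C_def by (rule ord_sign_cocycle[symmetric])
  have "exchange_double std_sign corner b c d x + exchange_double std_sign corner c d b x
     + exchange_double std_sign corner d b c x = (R - C) * (X - Y)"
    unfolding R C X_def Y_def
    by (simp add: exchange_double_def exchange_term_def ord_sign_skew[of s i] ord_sign_skew[of u i]
        ord_sign_skew[of u s] ord_sign_skew[of t j] ord_sign_skew[of v j] ord_sign_skew[of v t] algebra_simps)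
  also have "\<dots> = 0"
    by (auto simp: R_def C_def X_def Y_def)
  finally show ?thesis .
qed

lemma matrix_exchange_bracket: "exchange_bracket (twist \<zeta> \<xi>) std_sign corner"
proof
  fix b c d :: "'a \<times> 'a"
  obtain i j s t where [simp]: "b = (i, j)" "c = (s, t)" by (metis surj_pair)
  show "twist \<zeta> \<xi> b c = - twist \<zeta> \<xi> c b" by simp
  show "std_sign b c = - std_sign c b" using ord_sign_skew[of i s] ord_sign_skew[of j t] by simp
  show "twist \<zeta> \<xi> d (corner b c) + twist \<zeta> \<xi> d (corner c b) = twist \<zeta> \<xi> d b + twist \<zeta> \<xi> d c"
    by (rule twist_corner)
  show "corner b (corner b c) = corner b c" "corner (corner b c) b = b"
    "corner b (corner c b) = b" "corner (corner c b) b = corner c b" by simp_all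
  show "std_sign b (corner b c) + std_sign b (corner c b) = std_sign b c"
    by (simp add: ord_sign_self)
  show "exchange_double std_sign corner b c d x + exchange_double std_sign corner c d b x
     + exchange_double std_sign corner d b c x = 0" for x by (rule std_jacobi)
qed

lemma mat_bracket_eq: "mat_bracket \<zeta> \<xi> = exchange_bracket.bracket (twist \<zeta> \<xi>) std_sign corner"
proof (intro ext)
  fix p q :: "'a \<times> 'a" and a
  obtain i j s t where [simp]: "p = (i, j)" "q = (s, t)" by (metis surj_pair)
  show "mat_bracket \<zeta> \<xi> p q a = exchange_bracket.bracket (twist \<zeta> \<xi>) std_sign corner p q a"
    by (simp add: exchange_bracket.bracket_def[OF matrix_exchange_bracket] std_bracket_eq)
qed

text \<open>On pairs that involve some \<open>\<ell>_k\<close> the value is arbitrary, as \<open>prod_sign\<close> vanishes there.\<close>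

fun prod_corner :: "'n \<times> 'n + 'n::{finite,linorder} weight \<Rightarrow> 'n \<times> 'n + 'n weight \<Rightarrow> 'n \<times> 'n + 'n weight" where
  "prod_corner (Inl p) (Inl q) = Inl (corner p q)"
| "prod_corner b c = b"

fun prod_sign :: "'n \<times> 'n + 'n::{finite,linorder} weight \<Rightarrow> 'n \<times> 'n + 'n weight \<Rightarrow> complex" where
  "prod_sign (Inl p) (Inl q) = std_sign p q"
| "prod_sign b c = 0"

fun prod_twist :: "('n::{finite,linorder} \<Rightarrow> 'n lattice_P) \<Rightarrow> ('n \<Rightarrow> 'n lattice_P)
    \<Rightarrow> 'n \<times> 'n + 'n weight \<Rightarrow> 'n \<times> 'n + 'n weight \<Rightarrow> complex" where
  "prod_twist \<zeta> \<xi> (Inl p) (Inl q) = twist \<zeta> \<xi> p q"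
| "prod_twist \<zeta> \<xi> (Inr k) (Inl p) = of_int (basis_pair k p)"
| "prod_twist \<zeta> \<xi> (Inl p) (Inr k) = - of_int (basis_pair k p)"
| "prod_twist \<zeta> \<xi> (Inr k) (Inr l) = 0"

lemma exchange_term_prod:
  "exchange_term prod_sign prod_corner (Inl p) (Inl q) x = exchange_term std_sign corner p q (mat_proj x)"
  by (simp add: exchange_term_def mat_proj_def)

lemma exchange_double_prod:
  "exchange_double prod_sign prod_corner (Inl p) (Inl q) (Inl r) x
    = exchange_double std_sign corner p q r (mat_proj x)"
  by (simp add: exchange_double_def exchange_term_prod) (simp add: mat_proj_def)

lemma exchange_double_prod_Inr:
  "exchange_double prod_sign prod_corner (Inr k) c d x = 0"
  "exchange_double prod_sign prod_corner b (Inr k) d x = 0"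
  "exchange_double prod_sign prod_corner b c (Inr k) x = 0"
proof -
  have z: "prod_sign e (Inr k) = 0" for e :: "'a \<times> 'a + 'a weight" by (cases e) simp_all
  show "exchange_double prod_sign prod_corner (Inr k) c d x = 0"
    "exchange_double prod_sign prod_corner b (Inr k) d x = 0"
    "exchange_double prod_sign prod_corner b c (Inr k) x = 0"
    by (simp_all add: exchange_double_def exchange_term_def z)
qed

lemma prod_exchange_bracket: "exchange_bracket (prod_twist \<zeta> \<xi>) prod_sign prod_corner"
proof
  interpret mat: exchange_bracket "twist \<zeta> \<xi>" std_sign corner by (rule matrix_exchange_bracket)
  fix b c d :: "'a \<times> 'a + 'a weight"
  show "prod_twist \<zeta> \<xi> b c = - prod_twist \<zeta> \<xi> c b"
    by (cases b; cases c) (simp_all add: mat.\<tau>_skew[symmetric])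
  show "prod_sign b c = - prod_sign c b"
    by (cases b; cases c) (simp_all add: mat.\<theta>_skew[symmetric])
  show "exchange_double prod_sign prod_corner b c d x + exchange_double prod_sign prod_corner c d b x
     + exchange_double prod_sign prod_corner d b c x = 0" for x
    by (cases b; cases c; cases d)
      (simp_all only: exchange_double_prod_Inr exchange_double_prod std_jacobi add_0)
  assume nz: "prod_sign b c \<noteq> 0"
  then obtain p q where [simp]: "b = Inl p" "c = Inl q" by (cases b; cases c) simp_all
  have nz': "std_sign p q \<noteq> 0" using nz by simp
  show "prod_twist \<zeta> \<xi> d (prod_corner b c) + prod_twist \<zeta> \<xi> d (prod_corner c b)
      = prod_twist \<zeta> \<xi> d b + prod_twist \<zeta> \<xi> d c"
    by (cases d) (simp_all add: twist_corner basis_pair_corner flip: of_int_add)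
  show "prod_corner b (prod_corner b c) = prod_corner b c" "prod_corner (prod_corner b c) b = b"
    "prod_corner b (prod_corner c b) = b" "prod_corner (prod_corner c b) b = prod_corner c b"
    by (simp_all add: mat.m_exchange[OF nz'])
  show "prod_sign b (prod_corner b c) + prod_sign b (prod_corner c b) = prod_sign b c"
    by (simp add: mat.\<theta>_exchange[OF nz'])
qed

lemma prod_bracket_eq: "prod_bracket \<zeta> \<xi> = exchange_bracket.bracket (prod_twist \<zeta> \<xi>) prod_sign prod_corner"
proof (intro ext)
  fix b c :: "'a \<times> 'a + 'a weight" and x
  show "prod_bracket \<zeta> \<xi> b c x = exchange_bracket.bracket (prod_twist \<zeta> \<xi>) prod_sign prod_corner b c x"
    by (cases b; cases c)
      (simp_all add: exchange_bracket.bracket_def[OF prod_exchange_bracket] mat_bracket_eq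
        exchange_bracket.bracket_def[OF matrix_exchange_bracket] exchange_term_def mat_proj_def)
qed

abbreviation mat_flow where "mat_flow \<zeta> \<xi> \<equiv> exchange_bracket.flow (twist \<zeta> \<xi>) std_sign corner"
abbreviation prod_flow where "prod_flow \<zeta> \<xi> \<equiv> exchange_bracket.flow (prod_twist \<zeta> \<xi>) prod_sign prod_corner"

lemmas mat_flow_def = exchange_bracket.flow_def[OF matrix_exchange_bracket]
  and prod_flow_def = exchange_bracket.flow_def[OF prod_exchange_bracket]
  and mat_drift_def = exchange_bracket.drift_def[OF matrix_exchange_bracket]
  and prod_drift_def = exchange_bracket.drift_def[OF prod_exchange_bracket]

lemma mat_poisson_flows: "poisson_flows (mat_bracket \<zeta> \<xi>) UNIV (mat_flow \<zeta> \<xi>)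
    (exchange_bracket.flow_Jacobian (twist \<zeta> \<xi>) std_sign corner)"
  unfolding mat_bracket_eq by (rule exchange_bracket.poisson_flows[OF matrix_exchange_bracket]) simp

lemma prod_flow_Inr: "prod_flow \<zeta> \<xi> b t x $ Inr k = exp (prod_twist \<zeta> \<xi> b (Inr k) * x $ b * t) * x $ Inr k"
  by (cases b) (simp_all add: prod_flow_def prod_drift_def)

lemma prod_poisson_flows: "poisson_flows (prod_bracket \<zeta> \<xi>) prod_space (prod_flow \<zeta> \<xi>)
    (exchange_bracket.flow_Jacobian (prod_twist \<zeta> \<xi>) prod_sign prod_corner)"
  unfolding prod_bracket_eq
  by (rule exchange_bracket.poisson_flows[OF prod_exchange_bracket]) (simp add: prod_space_def prod_flow_Inr)

lemma mat_proj_flow_Inl: "mat_proj (prod_flow \<zeta> \<xi> (Inl p) t x) = mat_flow \<zeta> \<xi> p t (mat_proj x)"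
  by (simp add: prod_flow_def mat_flow_def prod_drift_def mat_drift_def mat_proj_def vec_eq_iff)

text \<open>The reason why the torus appears: the flow of \<open>\<ell>_k\<close> lies over a one-parameter subgroup.\<close>

lemma mat_proj_flow_Inr:
  "mat_proj (prod_flow \<zeta> \<xi> (Inr k) t x) = lambda_check k (exp (x $ Inr k * t)) (mat_proj x)"
  by (simp add: prod_flow_def prod_drift_def mat_proj_def vec_eq_iff lambda_check_def exp_power_int mult.assoc)

section \<open>The torus action and loaves\<close>

text \<open>The weights by which a torus element rescales the entries. As the action preserves the bracket, they
are multiplicative on rectangles.\<close>

definition exchange_character :: "('n \<times> 'n \<Rightarrow> complex) \<Rightarrow> bool" where
  "exchange_character f \<longleftrightarrow> (\<forall>p. f p \<noteq> 0) \<and> (\<forall>p q. f (corner p q) * f (corner q p) = f p * f q)"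

definition rescale :: "('n::finite \<times> 'n \<Rightarrow> complex) \<Rightarrow> complex ^ ('n \<times> 'n) \<Rightarrow> complex ^ ('n \<times> 'n)" where
  "rescale f a = (\<chi> p. f p * a $ p)"

lemma exchange_character_nonzero: "exchange_character f \<Longrightarrow> f p \<noteq> 0"
  and exchange_character_corner: "exchange_character f \<Longrightarrow> f (corner p q) * f (corner q p) = f p * f q"
  unfolding exchange_character_def by blast+

text \<open>Rescaling preserves the bracket and multiplies the Hamiltonian \<open>a_p\<close> by \<open>f p\<close>, hence its time by the
same factor.\<close>

lemma mat_flow_rescale:
  assumes "exchange_character f"
  shows "mat_flow \<zeta> \<xi> p t (rescale f a) = rescale f (mat_flow \<zeta> \<xi> p (f p * t) a)"
proof -
  have "mat_flow \<zeta> \<xi> p t (rescale f a) $ q = rescale f (mat_flow \<zeta> \<xi> p (f p * t) a) $ q" for q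
  proof -
    have "f (corner p q) * f (corner q p) = f p * f q"
      by (rule exchange_character_corner[OF assms])
    then have "f (corner p q) * a $ corner p q * (f (corner q p) * a $ corner q p)
        = f p * f q * (a $ corner p q * a $ corner q p)"
      by (simp only: mult.assoc mult.left_commute[of "a $ corner p q"])
        (simp only: mult.assoc[symmetric])
    moreover have "z * (f p * a $ p) * t = z * a $ p * (f p * t)" for z by simp
    ultimately show ?thesis
      unfolding rescale_def mat_flow_def mat_drift_def vec_lambda_beta
      by (simp only:) (simp add: distrib_left mult_ac)
  qed
  then show ?thesis by (simp add: vec_eq_iff)
qed

lemma lambda_check_eq_rescale: "lambda_check k c = rescale (\<lambda>p. c powi basis_pair k p)"
  by (simp add: lambda_check_def rescale_def fun_eq_iff)

lemma exchange_character_power: "c \<noteq> 0 \<Longrightarrow> exchange_character (\<lambda>p. c powi basis_pair k p)"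
  by (simp add: exchange_character_def basis_pair_corner flip: power_int_add)

lemma lambda_check_inverse: "c \<noteq> 0 \<Longrightarrow> lambda_check k (inverse c) (lambda_check k c a) = a"
  by (simp add: lambda_check_def vec_eq_iff power_int_inverse field_simps)

lemma lambda_check_Bij: "c \<noteq> 0 \<Longrightarrow> lambda_check k c \<in> Bij UNIV"
  unfolding Bij_def
  using lambda_check_inverse[of c k] lambda_check_inverse[of "inverse c" k]
  by (auto simp: extensional_def intro!: bij_betw_byWitness[of _ "lambda_check k (inverse c)"])

lemma S_mult_Bij: "g \<in> S_mult \<Longrightarrow> g \<in> Bij UNIV"
proof -
  interpret group "BijGroup (UNIV :: (complex ^ ('a \<times> 'a)) set)" by (rule group_BijGroup)
  have "S_mult \<subseteq> carrier (BijGroup (UNIV :: (complex ^ ('a \<times> 'a)) set))"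
    unfolding S_mult_def by (rule generate_incl) (auto simp: BijGroup_def lambda_check_Bij)
  then show "g \<in> S_mult \<Longrightarrow> g \<in> Bij UNIV" by (auto simp: BijGroup_def)
qed

text \<open>Inverses of generators are generators, so identity, generators and products suffice.\<close>

lemma S_mult_induct [consumes 1, case_names one generator comp]:
  assumes "g \<in> S_mult" and one: "P (\<lambda>a. a)"
    and gen: "\<And>k c. c \<noteq> 0 \<Longrightarrow> P (lambda_check k c)"
    and comp: "\<And>g h. \<lbrakk>g \<in> S_mult; h \<in> S_mult; P g; P h\<rbrakk> \<Longrightarrow> P (\<lambda>a. g (h a))"
  shows "P g"
proof -
  show ?thesis
    using assms(1) unfolding S_mult_def
  proof (induction rule: generate.induct)
    case one
    then show ?case using assms(2) by (simp add: BijGroup_def restrict_def)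
  next
    case (incl h)
    then show ?case using gen by blast
  next
    case (inv h)
    then obtain k c where h: "h = lambda_check k c" "c \<noteq> 0" by blast
    have inv: "inv_into UNIV h y = lambda_check k (inverse c) y" for y
      using lambda_check_Bij[OF h(2), of k] lambda_check_inverse[of "inverse c" k y] h
      by (intro inv_into_f_eq) (auto simp: Bij_def bij_betw_def)
    then have "inv\<^bsub>BijGroup UNIV\<^esub> h = lambda_check k (inverse c)"
      unfolding h(1) inv_BijGroup[OF lambda_check_Bij[OF h(2)]]
      using inv[unfolded h(1)] by (intro ext) simp
    then show ?case using gen[of "inverse c" k] h(2) by simp
  next
    case (eng g h)
    have "g \<in> Bij UNIV" "h \<in> Bij UNIV"
      using eng(1,2) S_mult_Bij unfolding S_mult_def by blast+
    then have "g \<otimes>\<^bsub>BijGroup UNIV\<^esub> h = (\<lambda>a. g (h a))"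
      by (simp add: BijGroup_def compose_def restrict_def)
    then show ?case using comp[unfolded S_mult_def, OF eng(1,2)] eng by simp
  qed
qed

lemma S_mult_comp_generator:
  assumes "g \<in> S_mult" "c \<noteq> 0"
  shows "(\<lambda>a. lambda_check k c (g a)) \<in> S_mult"
proof -
  have "g \<in> Bij UNIV" by (rule S_mult_Bij[OF assms(1)])
  then have "(\<lambda>a. lambda_check k c (g a)) = lambda_check k c \<otimes>\<^bsub>BijGroup UNIV\<^esub> g"
    using lambda_check_Bij[OF assms(2), of k] by (simp add: BijGroup_def compose_def restrict_def)
  also have "\<dots> \<in> S_mult"
    using assms unfolding S_mult_def by (intro generate.eng[OF generate.incl]) auto
  finally show ?thesis .
qed

lemma id_in_S_mult: "(\<lambda>a. a) \<in> S_mult"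
  using generate.one[of "BijGroup UNIV" "{lambda_check k c | k c. c \<noteq> 0}"]
  by (simp add: S_mult_def BijGroup_def restrict_def)

lemma S_mult_character:
  assumes "g \<in> S_mult"
  shows "\<exists>f. exchange_character f \<and> g = rescale f"
  using assms
proof (induction rule: S_mult_induct)
  case one
  show ?case
    by (intro exI[of _ "\<lambda>_. 1"]) (simp add: exchange_character_def rescale_def fun_eq_iff)
next
  case (generator k c)
  then show ?case using lambda_check_eq_rescale exchange_character_power by blast
next
  case (comp g h)
  then obtain f f' where f: "exchange_character f" "g = rescale f" "exchange_character f'" "h = rescale f'"
    by blast
  have "f (corner p q) * f' (corner p q) * (f (corner q p) * f' (corner q p)) = f p * f' p * (f q * f' q)" for p q
  proof -
    have "f (corner p q) * f' (corner p q) * (f (corner q p) * f' (corner q p))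
        = (f (corner p q) * f (corner q p)) * (f' (corner p q) * f' (corner q p))" by (simp only: mult_ac)
    also have "\<dots> = (f p * f q) * (f' p * f' q)" by (simp only: exchange_character_corner[OF f(1)] exchange_character_corner[OF f(3)])
    finally show ?thesis by (simp only: mult_ac)
  qed
  then have "exchange_character (\<lambda>p. f p * f' p)"
    unfolding exchange_character_def
    using exchange_character_nonzero[OF f(1)] exchange_character_nonzero[OF f(3)] by auto
  then show ?case
    by (intro exI[of _ "\<lambda>p. f p * f' p"]) (simp add: f rescale_def fun_eq_iff mult.assoc)
qed

theorem lemma5p5:
  fixes \<zeta> \<xi> :: "'n::{finite,linorder} \<Rightarrow> 'n lattice_P"
    and K :: "(complex ^ ('n \<times> 'n)) set"
  assumes "symplectic_loaf \<zeta> \<xi> K"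
  shows "\<exists>L. symplectic_leaf (prod_bracket \<zeta> \<xi>) prod_space L \<and> K = mat_proj ` L"
proof -
  interpret mat: poisson_flows "mat_bracket \<zeta> \<xi>" UNIV "mat_flow \<zeta> \<xi>"
    "exchange_bracket.flow_Jacobian (twist \<zeta> \<xi>) std_sign corner"
    by (rule mat_poisson_flows)
  interpret prod: poisson_flows "prod_bracket \<zeta> \<xi>" prod_space "prod_flow \<zeta> \<xi>"
    "exchange_bracket.flow_Jacobian (prod_twist \<zeta> \<xi>) prod_sign prod_corner"
    by (rule prod_poisson_flows)
  obtain L where L: "symplectic_leaf (mat_bracket \<zeta> \<xi>) UNIV L" and K: "K = (\<Union>g\<in>S_mult. g ` L)"
    using assms unfolding symplectic_loaf_def by blast
  obtain a where La: "L = mat.orbit a" using L mat.symplectic_leaf_iff_orbit by blast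
  define x0 :: "complex ^ ('n \<times> 'n + 'n weight)"
    where "x0 = (\<chi> b. case b of Inl p \<Rightarrow> a $ p | Inr k \<Rightarrow> 1)"
  have x0: "x0 \<in> prod_space" "mat_proj x0 = a"
    by (simp_all add: x0_def prod_space_def mat_proj_def vec_eq_iff)
  let ?O = "prod.orbit x0"
  have "symplectic_leaf (prod_bracket \<zeta> \<xi>) prod_space ?O"
    using x0(1) prod.symplectic_leaf_iff_orbit by blast
  moreover have "mat_proj ` ?O \<subseteq> K"
  proof clarify
    fix x assume "x \<in> ?O"
    then show "mat_proj x \<in> K"
    proof (induction rule: prod.orbit.induct)
      case orbit_refl
      have "mat_proj x0 \<in> (\<lambda>a. a) ` L" by (simp add: La x0(2) mat.orbit_refl)
      then show ?case using K id_in_S_mult by blast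
    next
      case (orbit_step x b t)
      then obtain g y where g: "g \<in> S_mult" "y \<in> L" "mat_proj x = g y" using K by blast
      show ?case
      proof (cases b)
        case (Inl p)
        obtain f where f: "exchange_character f" "g = rescale f" using S_mult_character[OF g(1)] by blast
        have "mat_proj (prod_flow \<zeta> \<xi> b t x) = g (mat_flow \<zeta> \<xi> p (f p * t) y)"
          by (simp add: Inl mat_proj_flow_Inl g(3) f(2) mat_flow_rescale[OF f(1)])
        moreover have "mat_flow \<zeta> \<xi> p (f p * t) y \<in> L"
          using g(2) mat.orbit_step unfolding La by blast
        ultimately show ?thesis using g(1) K by blast
      next
        case (Inr k)
        have "(\<lambda>a. lambda_check k (exp (x $ Inr k * t)) (g a)) \<in> S_mult"
          by (rule S_mult_comp_generator[OF g(1)]) simp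
        moreover have "mat_proj (prod_flow \<zeta> \<xi> b t x) = lambda_check k (exp (x $ Inr k * t)) (g y)"
          by (simp add: Inr mat_proj_flow_Inr g(3))
        ultimately show ?thesis using g(2) K by blast
      qed
    qed
  qed
  moreover have "K \<subseteq> mat_proj ` ?O"
  proof -
    have "L \<subseteq> mat_proj ` ?O"
    proof
      fix y assume "y \<in> L"
      then show "y \<in> mat_proj ` ?O"
        unfolding La
      proof (induction rule: mat.orbit.induct)
        case orbit_refl
        then show ?case using x0(2) prod.orbit_refl by blast
      next
        case (orbit_step y p t)
        then obtain x where "x \<in> ?O" "y = mat_proj x" by blast
        then show ?case
          using prod.orbit_step[of x x0 "Inl p" t] mat_proj_flow_Inl[of \<zeta> \<xi> p t x] by (metis imageI)
      qed
    qed
    moreover have "g y \<in> mat_proj ` ?O" if "g \<in> S_mult" "y \<in> mat_proj ` ?O" for g y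
      using that
    proof (induction arbitrary: y rule: S_mult_induct)
      case (generator k c)
      then obtain x where x: "x \<in> ?O" "y = mat_proj x" by blast
      have nz: "x $ Inr k \<noteq> 0"
        using prod.orbit_subset[OF x0(1)] x(1) by (auto simp: prod_space_def)
      \<comment> \<open>The time is chosen so that \<open>exp (\<ell>_k t) = c\<close>.\<close>
      have "mat_proj (prod_flow \<zeta> \<xi> (Inr k) (Ln c / x $ Inr k) x) = lambda_check k c y"
        using nz generator(1) by (simp add: mat_proj_flow_Inr x(2))
      then show ?case using prod.orbit_step[OF x(1)] by (metis imageI)
    qed simp_all
    ultimately show ?thesis unfolding K by blast
  qed
  ultimately show ?thesis by blast
qed

end
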